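(* Let $g\colon U\to V$ be a morphism of Lie algebras over a field of characteristic $0$, $T=U\oplus V$, and let $\theta\in C^n_{\mathbf{Lie}_{B\to W}}(T;T)$ and $\omega\in C^m_{\mathbf{Lie}_{B\to W}}(T;T)$ correspond to $(\theta_U,\theta_V,\theta_g)\in\Lambda^{n+1}(U,V)$ and $(\omega_U,\omega_V,\omega_g)\in\Lambda^{m+1}(U,V)$ respectively. Then $l_2(\theta,\omega)\in C^{n+m}_{\mathbf{Lie}_{B\to W}}(T;T)$ is given by $$l_2(\theta,\omega)(\mu_{n+m+1})=(-1)^{mn}\Big(\sum_{\sigma\in S_{m+1,n}}\mathrm{sgn}(\sigma)\,\theta_U\circ_1\omega_U\circ\sigma+(-1)^{m+n}\sum_{\sigma\in S_{n+1,m}}\mathrm{sgn}(\sigma)\,\omega_U\circ_1\theta_U\circ\sigma\Big),$$ $$l_2(\theta,\omega)(\nu_{n+m+1})=(-1)^{mn}\Big(\sum_{\sigma\in S_{m+1,n}}\mathrm{sgn}(\sigma)\,\theta_V\circ_1\omega_V\circ\sigma+(-1)^{m+n}\sum_{\sigma\in S_{n+1,m}}\mathrm{sgn}(\sigma)\,\omega_V\circ_1\theta_V\circ\sigma\Big),$$ $$\begin{aligned}l_2(\theta,\omega)(f_{n+m})={}&(-1)^{m(n-1)}\Big(\sum_{\sigma\in S_{m+1,n-1}}\mathrm{sgn}(\sigma)\,\theta_g\circ_1\omega_U\circ\sigma+\sum_{\sigma\in S_{n+1,m-1}}\mathrm{sgn}(\sigma)\,\omega_g\circ_1\theta_U\circ\sigma\Big)\\&+(-1)^n\Big(\sum_{\sigma\in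 S^<_{1,\ldots,1,m}}\mathrm{sgn}(\sigma)\,\theta_V(g^{\otimes n}\otimes\omega_g)\circ\sigma+\sum_{\sigma\in S^<_{1,\ldots,1,n}}\mathrm{sgn}(\sigma)\,\omega_V(g^{\otimes m}\otimes\theta_g)\circ\sigma\Big)\\&-\Big(\sum_{\sigma\in S^<_{n,m}}\mathrm{sgn}(\sigma)\,\mu_V(\theta_g\otimes\omega_g)\circ\sigma+(-1)^{n+m}\sum_{\sigma\in S^<_{m,n}}\mathrm{sgn}(\sigma)\,\mu_V(\omega_g\otimes\theta_g)\circ\sigma\Big).\end{aligned}$$ Here $S^<_{1,\ldots,1,m}$ has $n$ entries $1$ before the last entry $m$, and $S^<_{1,\ldots,1,n}$ has $m$ entries $1$ before the last entry $n$. In the last bracketed expression the first summand is zero if $m<n$ and the second is zero if $n<m$.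
   Context: $\mathbf k$ is a field of characteristic $0$; $(U,\mu_U)$, $(V,\mu_V)$ are Lie algebras over $\mathbf k$ with brackets $\mu_U,\mu_V$, and $g\colon U\to V$ is a Lie algebra morphism. $T=U\oplus V$ is two-colored with $T_B=U$, $T_W=V$; $\mathrm{End}_T$ is its 2-colored endomorphism PROP (multilinear maps between tensor products of $U$'s and $V$'s). **Permutations.** $S_{p,q}$ is the set of $(p,q)$-unshuffles: $\sigma\in\Sigma_{p+q}$ with $\sigma(1)<\cdots<\sigma(p)$ and $\sigma(p+1)<\cdots<\sigma(p+q)$. $S^<_{r_1,\ldots,r_l}$ is the set of $(r_1,\ldots,r_l)$-unshuffles with $\sigma(r_1+\cdots+r_{i-1}+1)<\sigma(r_1+\cdots+r_i+1)$ whenever $r_i=r_{i+1}$; it is assumed in this notation that $r_i\le r_{i+1}$ for all $i$. $(F\circ\sigma)(x_1,\ldots,x_N)=F(x_{\sigma(1)},\ldots,x_{\sigma(N)})$. **Minimal model.** $\mathbf{Lie}_{B\to W}$ is the 2-colored operad whose algebras are morphisms of Lie algebras. Its minimal model is $(\mathsf F(E),\partial)$, the free 2-colored PROP on the 2-colored $\Sigma$-bimodule $E$ with skew-symmetric generators $\mu_n\colon B^{\otimes n}\to B$ of degree $n-2$ ($n\ge2$), $\nu_n\colon W^{\otimes n}\to W$ of degree $n-2$ ($n\ge2$), $f_n\colon B^{\otimes n}\to W$ of degree $n-1$ ($n\ge1$), and $$\partial(\mu_n)=\sum_{\substack{i+j=n+1\\ i,j\ge2}}(-1)^{j(i-1)}\sum_{\sigma\in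 S_{j,i-1}}\mathrm{sgn}(\sigma)\,\mu_i\circ(\mu_j\otimes\mathrm{Id}^{\otimes i-1})\circ\sigma,$$ $\partial(\nu_n)$ is given by the same formula with $\nu$ in place of $\mu$, and $$\begin{aligned}\partial(f_n)={}&\sum_{l=2}^n\sum_{\substack{r_1+\cdots+r_l=n\\ r_1\le\cdots\le r_l}}(-1)^{\frac{l(l-1)}2+\sum_{i=1}^{l-1}r_i(l-i)}\sum_{\sigma\in S^<_{r_1,\ldots,r_l}}\mathrm{sgn}(\sigma)\,\nu_l(f_{r_1}\otimes\cdots\otimes f_{r_l})\circ\sigma\\&-\sum_{\substack{i+j=n+1\\ i\ge1,j\ge2}}(-1)^{j(i-1)}\sum_{\sigma\in S_{j,i-1}}\mathrm{sgn}(\sigma)\,f_i\circ(\mu_j\otimes\mathrm{Id}^{\otimes i-1})\circ\sigma.\end{aligned}$$ The morphism $g$ corresponds to $\beta\colon\mathsf F(E)\to\mathrm{End}_T$ with $\beta(\mu_2)=\mu_U$, $\beta(\nu_2)=\mu_V$, $\beta(f_1)=g$, and $\beta=0$ on all other generators. **Deformation complex.** $C^*_{\mathbf{Lie}_{B\to W}}(T;T)\cong\,\uparrow\mathrm{Hom}_\Sigma(E,\mathrm{End}_T)^{-*}$ ($\uparrow$ suspension, $-*$ reversed grading): $\theta\in C^p$, of degree $|\theta|=p$, is a color-preserving equivariant linear map $E\to\mathrm{End}_T$ supported on generators of degree $p-1$, identified with $(\theta_U,\theta_V,\theta_g):=(\theta(\mu_{p+1}),\theta(\nu_{p+1}),\theta(f_p))\in\Lambda^{p+1}(U,V)$,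 where $\Lambda^n(U,V)=\mathrm{Hom}(U^{\wedge n},U)\oplus\mathrm{Hom}(V^{\wedge n},V)\oplus\mathrm{Hom}(U^{\wedge n-1},V)$ for $n\ge1$. **Operations $l_k$.** For cochains $F_1,\ldots,F_k$ and a generator $\xi$, write $\partial(\xi)=\sum_s\Gamma_s$ as a sum of $E$-decorated graphs (as displayed). Then $$l_k(F_1,\ldots,F_k)(\xi)=(-1)^{\nu(F_1,\ldots,F_k)}\sum_s\sum_{(v_1,\ldots,v_k)}\gamma\big(\Gamma_s^{\{v_1,\ldots,v_k\}}[F_1,\ldots,F_k]\big),\qquad \nu(F_1,\ldots,F_k)=(k-1)|F_1|+(k-2)|F_2|+\cdots+|F_{k-1}|,$$ where $(v_1,\ldots,v_k)$ runs over all $k$-tuples of distinct vertices of $\Gamma_s$, the graph $\Gamma_s^{\{v_1,\ldots,v_k\}}[F_1,\ldots,F_k]$ is obtained by replacing the decoration $e_{v_i}$ of $v_i$ by $F_i(e_{v_i})$ and every other decoration $e_v$ by $\beta(e_v)$, and $\gamma$ is the resulting composite in $\mathrm{End}_T$. The only signs are the displayed ones and the coefficients in $\partial(\xi)$. **Notation.** $x\circ_1y=x(y\otimes\mathrm{Id}\otimes\cdots\otimes\mathrm{Id})$ plugs $y$ into the first input of $x$.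
   Formalization: If the last block has size 1, S^<_{1,…,1,m} (likewise with n) orders only the g-blocks (literally it is {id} and the formula fails); l_2(θ,ω) ∈ C^{n+m} is claimed only if n≠m or n is odd, since for n=m even and positive the f-component need not be skew; the formulas hold in all cases. *)

theory Defs
  imports Complex_Main "HOL-Combinatorics.Permutations" "HOL-Library.Poly_Mapping"
begin

section \<open>Lie algebras and multilinear maps\<close>

locale lie_algebra = vector_space scale
  for scale :: "'k::field \<Rightarrow> 'a::ab_group_add \<Rightarrow> 'a" +
  fixes bracket :: "'a \<Rightarrow> 'a \<Rightarrow> 'a"
  assumes linear_right: "Vector_Spaces.linear scale scale (bracket x)"
    and linear_left: "Vector_Spaces.linear scale scale (\<lambda>x. bracket x y)"
    and bracket_self: "bracket x x = 0"
    and jacobi: "bracket x (bracket y z) + bracket y (bracket z x) + bracket z (bracket x y) = 0"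

definition lie_morphism ::
  "('k::field \<Rightarrow> 'u::ab_group_add \<Rightarrow> 'u) \<Rightarrow> ('u \<Rightarrow> 'u \<Rightarrow> 'u) \<Rightarrow>
   ('k \<Rightarrow> 'v::ab_group_add \<Rightarrow> 'v) \<Rightarrow> ('v \<Rightarrow> 'v \<Rightarrow> 'v) \<Rightarrow> ('u \<Rightarrow> 'v) \<Rightarrow> bool" where
  "lie_morphism sU \<mu>U sV \<mu>V g \<longleftrightarrow>
     Vector_Spaces.linear sU sV g \<and> (\<forall>x y. g (\<mu>U x y) = \<mu>V (g x) (g y))"

text \<open>An operation with \<open>n\<close> inputs is a function on lists; only its values on lists of length \<open>n\<close>
  carry information. In \<open>multilinear_maps\<close> the remaining values are normalised to \<open>0\<close>.\<close>

definition multilinear_maps ::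
  "('k::field \<Rightarrow> 'a::ab_group_add \<Rightarrow> 'a) \<Rightarrow> ('k \<Rightarrow> 'b::ab_group_add \<Rightarrow> 'b) \<Rightarrow> nat \<Rightarrow>
   ('a list \<Rightarrow> 'b) set" where
  "multilinear_maps s s' n =
     {F. (\<forall>xs i. length xs = n \<and> i < n \<longrightarrow> Vector_Spaces.linear s s' (\<lambda>x. F (xs[i := x]))) \<and>
         (\<forall>xs. length xs \<noteq> n \<longrightarrow> F xs = 0)}"

definition skew_maps ::
  "('k::field \<Rightarrow> 'a::ab_group_add \<Rightarrow> 'a) \<Rightarrow> ('k \<Rightarrow> 'b::ab_group_add \<Rightarrow> 'b) \<Rightarrow> nat \<Rightarrow>
   ('a list \<Rightarrow> 'b) set" where
  "skew_maps s s' n =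
     {F \<in> multilinear_maps s s' n. \<forall>\<sigma> xs. \<sigma> permutes {..<n} \<and> length xs = n \<longrightarrow>
        F (permute_list \<sigma> xs) = s' (of_int (sign \<sigma>)) (F xs)}"

definition unary :: "('a \<Rightarrow> 'b) \<Rightarrow> 'a list \<Rightarrow> 'b" where
  "unary g xs = g (xs ! 0)"

definition binary :: "('a \<Rightarrow> 'a \<Rightarrow> 'b) \<Rightarrow> 'a list \<Rightarrow> 'b" where
  "binary b xs = b (xs ! 0) (xs ! 1)"

text \<open>\<open>circ1 j x y\<close> is \<open>x\<close> with \<open>y\<close>, which has \<open>j\<close> inputs, plugged into its first input.\<close>

definition circ1 :: "nat \<Rightarrow> ('a list \<Rightarrow> 'b) \<Rightarrow> ('a list \<Rightarrow> 'a) \<Rightarrow> 'a list \<Rightarrow> 'b" where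
  "circ1 j x y xs = x (y (take j xs) # drop j xs)"

text \<open>In a tensor product each factor is listed together with its number of inputs.\<close>

fun tensor :: "(nat \<times> ('a list \<Rightarrow> 'b)) list \<Rightarrow> 'a list \<Rightarrow> 'b list" where
  "tensor [] xs = []"
| "tensor ((r, F) # Fs) xs = F (take r xs) # tensor Fs (drop r xs)"

definition comp_tensor ::
  "('b list \<Rightarrow> 'c) \<Rightarrow> (nat \<times> ('a list \<Rightarrow> 'b)) list \<Rightarrow> 'a list \<Rightarrow> 'c" where
  "comp_tensor x Fs xs = x (tensor Fs xs)"


section \<open>Unshuffles\<close>

text \<open>Inputs are numbered from \<open>0\<close>, so permutations act on \<open>{..<N}\<close>. The composite of \<open>F\<close> with
  \<open>\<sigma>\<close> sends \<open>xs\<close> to \<open>F (permute_list \<sigma> xs)\<close>, where \<open>permute_list \<sigma> xs ! i = xs ! \<sigma> i\<close>.\<close>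

definition block_start :: "nat list \<Rightarrow> nat \<Rightarrow> nat" where
  "block_start rs i = sum_list (take i rs)"

definition unshuffles :: "nat list \<Rightarrow> (nat \<Rightarrow> nat) set" where
  "unshuffles rs =
     {\<sigma>. \<sigma> permutes {..<sum_list rs} \<and>
         (\<forall>i<length rs. strict_mono_on {block_start rs i..<block_start rs (Suc i)} \<sigma>)}"

definition unshuffles_lt :: "nat list \<Rightarrow> (nat \<Rightarrow> nat) set" where
  "unshuffles_lt rs =
     {\<sigma> \<in> unshuffles rs. \<forall>i. Suc i < length rs \<and> rs ! i = rs ! Suc i \<longrightarrow>
        \<sigma> (block_start rs i) < \<sigma> (block_start rs (Suc i))}"

text \<open>The index set for sums of \<open>x (g \<otimes> \<dots> \<otimes> g \<otimes> y)\<close> with \<open>n\<close> factors \<open>g\<close> and \<open>y\<close> of arity \<open>m\<close>.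
  Only the \<open>n\<close> blocks occupied by \<open>g\<close> are ordered among each other; the last block is never
  compared with them. For \<open>m \<noteq> 1\<close> this is \<open>unshuffles_lt (replicate n 1 @ [m])\<close>. For \<open>m = 1\<close> it is
  larger: the block of \<open>y\<close> then has the same size as those of \<open>g\<close>, but it is not interchangeable
  with them, and \<open>unshuffles_lt\<close>, which compares sizes only, would contain just the identity.\<close>

definition unshuffles_lt_ones :: "nat \<Rightarrow> nat \<Rightarrow> (nat \<Rightarrow> nat) set" where
  "unshuffles_lt_ones n m =
     {\<sigma> \<in> unshuffles (replicate n 1 @ [m]). \<forall>i. Suc i < n \<longrightarrow> \<sigma> i < \<sigma> (Suc i)}"

lemma unshuffles_lt_ones_eq:
  assumes "m \<noteq> 1"
  shows "unshuffles_lt_ones n m = unshuffles_lt (replicate n 1 @ [m])"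
proof -
  have start: "block_start (replicate n 1 @ [m]) i = i" if "i \<le> n" for i
    using that by (simp add: block_start_def min_def sum_list_replicate)
  have iff: "(Suc i < length (replicate n 1 @ [m]) \<and>
      (replicate n 1 @ [m]) ! i = (replicate n 1 @ [m]) ! Suc i) \<longleftrightarrow> Suc i < n" for i
    using assms by (auto simp: nth_append less_Suc_eq)
  show ?thesis
    unfolding unshuffles_lt_ones_def unshuffles_lt_def iff
    using start by (auto simp: Suc_lessD less_imp_le)
qed

text \<open>The sum over \<open>\<sigma> \<in> S\<close> of the composites of \<open>F\<close> with \<open>\<sigma>\<close>, weighted by \<open>sign \<sigma>\<close>.\<close>

definition sgn_sum ::
  "('k::field \<Rightarrow> 'b::ab_group_add \<Rightarrow> 'b) \<Rightarrow> (nat \<Rightarrow> nat) set \<Rightarrow> ('a list \<Rightarrow> 'b) \<Rightarrow> 'a list \<Rightarrow> 'b"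
  where
  "sgn_sum s S F xs = (\<Sum>\<sigma>\<in>S. s (of_int (sign \<sigma>)) (F (permute_list \<sigma> xs)))"


section \<open>Generators and cochains\<close>

datatype generator = Mu nat | Nu nat | Fn nat

fun is_generator :: "generator \<Rightarrow> bool" where
  "is_generator (Mu n) \<longleftrightarrow> 2 \<le> n"
| "is_generator (Nu n) \<longleftrightarrow> 2 \<le> n"
| "is_generator (Fn n) \<longleftrightarrow> 1 \<le> n"

fun generator_degree :: "generator \<Rightarrow> int" where
  "generator_degree (Mu n) = int n - 2"
| "generator_degree (Nu n) = int n - 2"
| "generator_degree (Fn n) = int n - 1"

text \<open>Colour-preserving maps from the generators to the endomorphism PROP. The colours (black for
  \<open>'u\<close>, white for \<open>'v\<close>) are enforced by the types; a map is given by its values on all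
  \<open>\<mu>\<^sub>n\<close>, \<open>\<nu>\<^sub>n\<close>, \<open>f\<^sub>n\<close>.\<close>

record ('u, 'v) gen_map =
  on_mu :: "nat \<Rightarrow> 'u list \<Rightarrow> 'u"
  on_nu :: "nat \<Rightarrow> 'v list \<Rightarrow> 'v"
  on_f :: "nat \<Rightarrow> 'u list \<Rightarrow> 'v"

text \<open>Maps with multilinear values supported on the generators of degree \<open>p - 1\<close>; the cochains of
  degree \<open>p\<close> are the equivariant ones. As the generators are skew-symmetric, equivariance means
  that the values are skew.\<close>

definition graded_maps ::
  "('k::field \<Rightarrow> 'u::ab_group_add \<Rightarrow> 'u) \<Rightarrow> ('k \<Rightarrow> 'v::ab_group_add \<Rightarrow> 'v) \<Rightarrow> nat \<Rightarrow>
   ('u, 'v) gen_map set" where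
  "graded_maps sU sV p =
     {\<theta>. (\<forall>k. on_mu \<theta> k \<in> multilinear_maps sU sU k \<and>
              on_nu \<theta> k \<in> multilinear_maps sV sV k \<and>
              on_f \<theta> k \<in> multilinear_maps sU sV k) \<and>
         (\<forall>k. \<not> (is_generator (Mu k) \<and> generator_degree (Mu k) = int p - 1) \<longrightarrow>
              on_mu \<theta> k = (\<lambda>_. 0)) \<and>
         (\<forall>k. \<not> (is_generator (Nu k) \<and> generator_degree (Nu k) = int p - 1) \<longrightarrow>
              on_nu \<theta> k = (\<lambda>_. 0)) \<and>
         (\<forall>k. \<not> (is_generator (Fn k) \<and> generator_degree (Fn k) = int p - 1) \<longrightarrow>
              on_f \<theta> k = (\<lambda>_. 0))}"

definition cochains ::
  "('k::field \<Rightarrow> 'u::ab_group_add \<Rightarrow> 'u) \<Rightarrow> ('k \<Rightarrow> 'v::ab_group_add \<Rightarrow> 'v) \<Rightarrow> nat \<Rightarrow>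
   ('u, 'v) gen_map set" where
  "cochains sU sV p =
     {\<theta> \<in> graded_maps sU sV p.
        \<forall>k. on_mu \<theta> k \<in> skew_maps sU sU k \<and>
            on_nu \<theta> k \<in> skew_maps sV sV k \<and>
            on_f \<theta> k \<in> skew_maps sU sV k}"

definition beta ::
  "('u::ab_group_add \<Rightarrow> 'u \<Rightarrow> 'u) \<Rightarrow> ('v::ab_group_add \<Rightarrow> 'v \<Rightarrow> 'v) \<Rightarrow> ('u \<Rightarrow> 'v) \<Rightarrow>
   ('u, 'v) gen_map" where
  "beta \<mu>U \<mu>V g =
     \<lparr>on_mu = (\<lambda>k. if k = 2 then binary \<mu>U else (\<lambda>_. 0)),
      on_nu = (\<lambda>k. if k = 2 then binary \<mu>V else (\<lambda>_. 0)),
      on_f = (\<lambda>k. if k = 1 then unary g else (\<lambda>_. 0))\<rparr>"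


section \<open>The differential of the minimal model\<close>

text \<open>The decorated graphs occurring in the differential. \<open>Bracket_Graph i j \<sigma>\<close> stands for
  \<open>\<mu>\<^sub>i (\<mu>\<^sub>j \<otimes> Id \<otimes> \<dots> \<otimes> Id) \<sigma>\<close> in the differential of \<open>\<mu>\<^sub>n\<close> and for the same graph with \<open>\<nu>\<close> in place
  of \<open>\<mu>\<close> in that of \<open>\<nu>\<^sub>n\<close>; \<open>Nu_Fs [r\<^sub>1, \<dots>, r\<^sub>l] \<sigma>\<close> stands for
  \<open>\<nu>\<^sub>l (f\<^bsub>r\<^sub>1\<^esub> \<otimes> \<dots> \<otimes> f\<^bsub>r\<^sub>l\<^esub>) \<sigma>\<close>, and \<open>F_Mu i j \<sigma>\<close> for \<open>f\<^sub>i (\<mu>\<^sub>j \<otimes> Id \<otimes> \<dots> \<otimes> Id) \<sigma>\<close>.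
  Vertices are numbered from the root, which is \<open>0\<close>, then left to right. The differential of a
  generator is a formal integral combination of such graphs.\<close>

datatype bracket_graph = Bracket_Graph nat nat "nat \<Rightarrow> nat"

datatype f_graph = Nu_Fs "nat list" "nat \<Rightarrow> nat" | F_Mu nat nat "nat \<Rightarrow> nat"

definition boundary_bracket :: "nat \<Rightarrow> bracket_graph \<Rightarrow>\<^sub>0 int" where
  "boundary_bracket n =
     (\<Sum>(i, j)\<in>{(i, j). i + j = n + 1 \<and> 2 \<le> i \<and> 2 \<le> j}. \<Sum>\<sigma>\<in>unshuffles [j, i - 1].
        Poly_Mapping.single (Bracket_Graph i j \<sigma>) ((-1) ^ (j * (i - 1)) * sign \<sigma>))"

definition boundary_f :: "nat \<Rightarrow> f_graph \<Rightarrow>\<^sub>0 int" where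
  "boundary_f n =
     (\<Sum>l=2..n. \<Sum>rs\<in>{rs. length rs = l \<and> 0 \<notin> set rs \<and> sum_list rs = n \<and> sorted rs}.
        \<Sum>\<sigma>\<in>unshuffles_lt rs.
          Poly_Mapping.single (Nu_Fs rs \<sigma>)
            ((-1) ^ (l * (l - 1) div 2 + (\<Sum>i=1..l-1. rs ! (i - 1) * (l - i))) * sign \<sigma>))
     - (\<Sum>(i, j)\<in>{(i, j). i + j = n + 1 \<and> 1 \<le> i \<and> 2 \<le> j}. \<Sum>\<sigma>\<in>unshuffles [j, i - 1].
          Poly_Mapping.single (F_Mu i j \<sigma>) ((-1) ^ (j * (i - 1)) * sign \<sigma>))"

fun vertices_bracket :: "bracket_graph \<Rightarrow> nat set" where
  "vertices_bracket (Bracket_Graph i j \<sigma>) = {0, 1}"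

fun vertices_f :: "f_graph \<Rightarrow> nat set" where
  "vertices_f (Nu_Fs rs \<sigma>) = {..length rs}"
| "vertices_f (F_Mu i j \<sigma>) = {0, 1}"

text \<open>The composite of a graph in which the decoration \<open>e\<close> of the vertex \<open>v\<close> is replaced by \<open>D v e\<close>.
  For bracket graphs, \<open>D v\<close> is the restriction to the \<open>\<mu>\<^sub>n\<close> or to the \<open>\<nu>\<^sub>n\<close>.\<close>

fun gamma_bracket :: "(nat \<Rightarrow> nat \<Rightarrow> 'a list \<Rightarrow> 'a) \<Rightarrow> bracket_graph \<Rightarrow> 'a list \<Rightarrow> 'a" where
  "gamma_bracket D (Bracket_Graph i j \<sigma>) xs = circ1 j (D 0 i) (D 1 j) (permute_list \<sigma> xs)"

fun gamma_f :: "(nat \<Rightarrow> ('u, 'v) gen_map) \<Rightarrow> f_graph \<Rightarrow> 'u list \<Rightarrow> 'v" where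
  "gamma_f D (Nu_Fs rs \<sigma>) xs =
     comp_tensor (on_nu (D 0) (length rs))
       (map (\<lambda>i. (rs ! i, on_f (D (Suc i)) (rs ! i))) [0..<length rs]) (permute_list \<sigma> xs)"
| "gamma_f D (F_Mu i j \<sigma>) xs = circ1 j (on_f (D 0) i) (on_mu (D 1) j) (permute_list \<sigma> xs)"


section \<open>The operations \<open>l\<^sub>k\<close>\<close>

definition vertex_tuples :: "nat \<Rightarrow> nat set \<Rightarrow> nat list set" where
  "vertex_tuples k A = {vs. length vs = k \<and> distinct vs \<and> set vs \<subseteq> A}"

text \<open>\<open>F\<^sub>i\<close> is used at \<open>v\<^sub>i\<close>, and \<open>b\<close> at all other vertices.\<close>

definition insertion ::
  "('u, 'v) gen_map \<Rightarrow> ('u, 'v) gen_map list \<Rightarrow> nat list \<Rightarrow> nat \<Rightarrow> ('u, 'v) gen_map" where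
  "insertion b Fs vs v = (case map_of (zip vs Fs) v of None \<Rightarrow> b | Some F \<Rightarrow> F)"

definition nu_exponent :: "nat list \<Rightarrow> nat" where
  "nu_exponent ps = (\<Sum>i=1..length ps. (length ps - i) * ps ! (i - 1))"

text \<open>\<open>l_op sU sV b [(p\<^sub>1, F\<^sub>1), \<dots>, (p\<^sub>k, F\<^sub>k)]\<close> is \<open>l\<^sub>k(F\<^sub>1, \<dots>, F\<^sub>k)\<close>, where \<open>p\<^sub>i\<close> is the degree of \<open>F\<^sub>i\<close>
  and \<open>b\<close> is used at the remaining vertices. No Koszul signs are involved. As a consequence
  \<open>l\<^sub>2(F\<^sub>1, F\<^sub>2)\<close> need not be equivariant if both degrees equal the same even \<open>p > 0\<close>: the terms
  \<open>[F\<^sub>1(f\<^sub>p), F\<^sub>2(f\<^sub>p)] + [F\<^sub>2(f\<^sub>p), F\<^sub>1(f\<^sub>p)]\<close> of the value on \<open>f\<^bsub>2p\<^esub>\<close> are summed over unshuffles up to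
  exchange of the two blocks, an even permutation under which their sum changes sign.\<close>

definition l_op ::
  "('k::field \<Rightarrow> 'u::ab_group_add \<Rightarrow> 'u) \<Rightarrow> ('k \<Rightarrow> 'v::ab_group_add \<Rightarrow> 'v) \<Rightarrow>
   ('u, 'v) gen_map \<Rightarrow> (nat \<times> ('u, 'v) gen_map) list \<Rightarrow> ('u, 'v) gen_map" where
  "l_op sU sV b pFs =
     (let ps = map fst pFs; Fs = map snd pFs; k = length pFs in
      \<lparr>on_mu = (\<lambda>N xs. if length xs \<noteq> N then 0 else
         sU ((-1) ^ nu_exponent ps)
           (\<Sum>\<Gamma>\<in>Poly_Mapping.keys (boundary_bracket N). sU (of_int (Poly_Mapping.lookup (boundary_bracket N) \<Gamma>))
              (\<Sum>vs\<in>vertex_tuples k (vertices_bracket \<Gamma>).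
                 gamma_bracket (\<lambda>v. on_mu (insertion b Fs vs v)) \<Gamma> xs))),
       on_nu = (\<lambda>N xs. if length xs \<noteq> N then 0 else
         sV ((-1) ^ nu_exponent ps)
           (\<Sum>\<Gamma>\<in>Poly_Mapping.keys (boundary_bracket N). sV (of_int (Poly_Mapping.lookup (boundary_bracket N) \<Gamma>))
              (\<Sum>vs\<in>vertex_tuples k (vertices_bracket \<Gamma>).
                 gamma_bracket (\<lambda>v. on_nu (insertion b Fs vs v)) \<Gamma> xs))),
       on_f = (\<lambda>N xs. if length xs \<noteq> N then 0 else
         sV ((-1) ^ nu_exponent ps)
           (\<Sum>\<Gamma>\<in>Poly_Mapping.keys (boundary_f N). sV (of_int (Poly_Mapping.lookup (boundary_f N) \<Gamma>))
              (\<Sum>vs\<in>vertex_tuples k (vertices_f \<Gamma>).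
                 gamma_f (insertion b Fs vs) \<Gamma> xs)))\<rparr>)"

end

theory Submission
  imports Defs
begin

text \<open>
  Two cochains of degrees \<open>n\<close> and \<open>m\<close> inserted at two vertices of a graph of the differential leave
  only few graphs with a nonzero composite, because every decoration is supported in one arity and
  \<open>\<beta>\<close> is nonzero on \<open>\<mu>\<^sub>2\<close>, \<open>\<nu>\<^sub>2\<close>, \<open>f\<^sub>1\<close> only. In \<open>\<nu>\<^sub>l (f\<^bsub>r\<^sub>1\<^esub> \<otimes> \<dots> \<otimes> f\<^bsub>r\<^sub>l\<^esub>)\<close> either one cochain sits at
  the root and the other at one \<open>f\<close>, which forces the block sizes \<open>1, \<dots>, 1, m\<close> (or \<open>n\<close>), or both
  sit at the two \<open>f\<close> below \<open>\<nu>\<^sub>2\<close>. For \<open>m = 1\<close> all blocks have size \<open>1\<close>, the only unshuffle in the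
  differential is the identity, and the position of the second cochain takes over the role of the
  unshuffle, by skew-symmetry of the root.

  Equivariance of the result is a coset argument: \<open>(p, q)\<close>-unshuffles represent the left cosets of
  \<open>S\<^sub>p \<times> S\<^sub>q\<close>, so a signed sum over them of a map that is skew in each block is skew. For \<open>n = m\<close> odd
  the two sums over ordered unshuffles combine to one sum over all unshuffles, since the exchange of
  the two blocks is then odd.
\<close>
section \<open>Skew maps and unshuffles\<close>

text \<open>Three points shape the details. First, degree \<open>0\<close>: such a cochain would
  live on mu_1, nu_1 and f_0, none of which is a generator, so it is zero. Truncated subtraction in
  \<open>n - 1\<close> and \<open>m - 1\<close> spoils arities and parities exactly in this case,
  and there all affected terms vanish. Second, the signs: the prefactor of \<open>l_2\<close> is
  (-1)^n. Blocks 1, ..., 1, m have coefficient +1 in the differential, so their terms keep (-1)^n;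
  blocks n, m have coefficient (-1)^(1+n), which leaves -1, and blocks m, n leave -(-1)^(n+m).
  Partitions are listed in increasing order, so for n different from m only one of the last two
  exists; this is why one of the bracket terms is zero. Third, composites such as
  \<open>circ1\<close> are not normalised to \<open>0\<close> on lists of the wrong length.
  Multilinearity and skewness are therefore carried by predicates that look at lists of the right
  length only, and the normalisation reenters with the length test in \<open>l_op\<close>.\<close>

lemma take_drop_permute_list:
  assumes "h permutes {..<p}" "p \<le> length xs"
  shows "take p (permute_list h xs) = permute_list h (take p xs)"
    and "drop p (permute_list h xs) = drop p xs"
proof -
  have h: "h i < p" if "i < p" for i
    using that permutes_in_image[OF assms(1), of i] by simp
  have h': "h i = i" if "\<not> i < p" for i
    using that permutes_not_in[OF assms(1), of i] by simp
  show "take p (permute_list h xs) = permute_list h (take p xs)"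
    using assms(2) h by (intro nth_equalityI) (auto simp: permute_list_def)
  show "drop p (permute_list h xs) = drop p xs"
    using assms(2) h' by (intro nth_equalityI) (auto simp: permute_list_def)
qed

lemma take_drop_permute_list_transpose:
  assumes "p \<le> a" "p \<le> b" "a < length xs" "b < length xs"
  shows "take p (permute_list (transpose a b) xs) = take p xs"
    and "drop p (permute_list (transpose a b) xs) =
      permute_list (transpose (a - p) (b - p)) (drop p xs)"
  using assms
  by (auto intro!: nth_equalityI simp: permute_list_def transpose_def)

lemma append_permute_list_transpose:
  assumes "a < length ys" "b < length ys"
  shows "zs @ permute_list (transpose a b) ys =
    permute_list (transpose (length zs + a) (length zs + b)) (zs @ ys)"
  using assms
  by (auto intro!: nth_equalityI simp: permute_list_def transpose_def nth_append)

lemma permute_list_append: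
  assumes "h permutes {..<length xs}"
  shows "permute_list h (xs @ ys) = permute_list h xs @ ys"
  using take_drop_permute_list[OF assms, of "xs @ ys"] append_take_drop_id
    [of "length xs" "permute_list h (xs @ ys)"]
  by simp

text \<open>The set \<open>A\<close> of positions is a parameter because a composite is at first
  skew only within each block of its inputs; skewness in all inputs appears after summation over
  unshuffles.\<close>

definition skew_on ::
  "('k::field \<Rightarrow> 'b::ab_group_add \<Rightarrow> 'b) \<Rightarrow> nat \<Rightarrow> nat set \<Rightarrow> ('a list \<Rightarrow> 'b) \<Rightarrow> bool" where
  "skew_on s n A F \<longleftrightarrow> (\<forall>\<sigma> xs. \<sigma> permutes A \<longrightarrow> length xs = n \<longrightarrow>
     F (permute_list \<sigma> xs) = s (of_int (sign \<sigma>)) (F xs))"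

lemma skew_onD:
  "skew_on s n A F \<Longrightarrow> \<sigma> permutes A \<Longrightarrow> length xs = n \<Longrightarrow>
    F (permute_list \<sigma> xs) = s (of_int (sign \<sigma>)) (F xs)"
  by (simp add: skew_on_def)

lemma sign_compose_permutes:
  assumes "p permutes A" "q permutes B" "finite A" "finite B"
  shows "sign (p \<circ> q) = sign p * sign q"
  using assms by (metis permutation_permutes sign_compose)

lemma of_int_sign_mult_self [simp]:
  "of_int (sign p) * of_int (sign p) = (1 :: 'k::field)"
  "of_int (sign p) * (of_int (sign p) * x) = (x :: 'k)"
  by (cases p rule: sign_cases; simp)+

lemma scale_neg_one: "vector_space s \<Longrightarrow> s (- 1) x = - x"
  by (metis module.scale_minus_left module_iff_vector_space vector_space.vector_space_assms(4))

text \<open>Transpositions generate the permutations of \<open>A\<close>, and both sides are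
  multiplicative. In \<open>permute_list\<close> the left factor of a composite acts first on the
  list, so the induction peels off the transposition next to \<open>xs\<close>.\<close>

lemma skew_on_transposeI:
  assumes s: "vector_space s" and A: "A \<subseteq> {..<n}"
    and F: "\<And>a b xs. a \<in> A \<Longrightarrow> b \<in> A \<Longrightarrow> a \<noteq> b \<Longrightarrow> length xs = n \<Longrightarrow>
      F (permute_list (transpose a b) xs) = - F xs"
  shows "skew_on s n A F"
proof -
  interpret vector_space s by fact
  have fin: "finite A"
    using A finite_subset by blast
  have "F (permute_list \<sigma> xs) = s (of_int (sign \<sigma>)) (F xs)"
    if "\<sigma> permutes A" "length xs = n" for \<sigma> xs
    using that(1) fin that(2)
  proof (induction arbitrary: xs rule: permutes_induct)
    case id
    then show ?case by simp
  next
    case (swap a b p)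
    have "permute_list (transpose a b \<circ> p) xs = permute_list p (permute_list (transpose a b) xs)"
      using permutes_subset[OF swap.hyps(4) A] swap.prems by (simp add: permute_list_compose)
    moreover have "sign (transpose a b \<circ> p) = - sign p"
      using sign_compose_permutes[OF permutes_swap_id[OF swap.hyps(1,2)] swap.hyps(4) fin fin]
        swap.hyps(3)
      by (simp add: sign_swap_id)
    ultimately show ?case
      using swap.IH[of "permute_list (transpose a b) xs"] F[OF swap.hyps(1-3) swap.prems] swap.prems
      by (simp only: length_permute_list of_int_minus scale_minus_left scale_minus_right)
  qed
  then show ?thesis by (simp add: skew_on_def)
qed

lemma skew_on_transposeD:
  assumes "vector_space s" "skew_on s n A F" "a \<in> A" "b \<in> A" "a \<noteq> b" "length xs = n"
  shows "F (permute_list (transpose a b) xs) = - F xs"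
  using skew_onD[OF assms(2) permutes_swap_id[OF assms(3,4)] assms(6)] assms(1,5)
  by (simp add: sign_swap_id scale_neg_one)

text \<open>A permutation that preserves the first block preserves the second as well, hence is a
  product of one permutation of each block; the two hypotheses apply to one factor each.\<close>

lemma skew_on_blocks:
  assumes s: "vector_space s"
    and 1: "skew_on s (p + q) {..<p} F" and 2: "skew_on s (p + q) {p..<p + q} F"
    and h: "h permutes {..<p + q}" "h ` {..<p} = {..<p}" and xs: "length xs = p + q"
  shows "F (permute_list h xs) = s (of_int (sign h)) (F xs)"
proof -
  interpret vector_space s by fact
  define h1 where "h1 i = (if i < p then h i else i)" for i
  define h2 where "h2 i = (if i < p then i else h i)" for i
  have lt: "h i < p \<longleftrightarrow> i < p" for i
    using h(2) permutes_inj[OF h(1)] by (metis imageE image_eqI inj_eq lessThan_iff)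
  have inj: "inj h"
    using h(1) by (rule permutes_inj)
  have h1: "h1 permutes {..<p}"
    using inj lt by (intro inj_imp_permutes) (auto simp: h1_def inj_on_def)
  have "h i < p + q" if "i < p + q" for i
    using that permutes_in_image[OF h(1), of i] by simp
  moreover have "h i = i" if "p + q \<le> i" for i
    using that permutes_not_in[OF h(1), of i] by simp
  moreover have "p \<le> h i" if "p \<le> i" for i
    using lt[of i] that by linarith
  moreover have "inj_on h2 {p..<p + q}"
    using inj by (auto simp: h2_def inj_on_def)
  ultimately have h2: "h2 permutes {p..<p + q}"
    by (intro inj_imp_permutes) (auto simp: h2_def)
  have comp: "h = h2 \<circ> h1"
    by (rule ext) (simp add: h1_def h2_def lt)
  have h1': "h1 permutes {..<p + q}"
    by (rule permutes_subset[OF h1]) auto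
  have eq: "permute_list h xs = permute_list h1 (permute_list h2 xs)"
    unfolding comp by (rule permute_list_compose) (simp add: xs h1')
  have sgn: "sign h = sign h1 * sign h2"
    unfolding comp by (subst sign_compose_permutes[OF h2 h1]) auto
  have "F (permute_list h xs) = s (of_int (sign h1)) (F (permute_list h2 xs))"
    unfolding eq by (rule skew_onD[OF 1 h1]) (simp add: xs)
  also have "F (permute_list h2 xs) = s (of_int (sign h2)) (F xs)"
    by (rule skew_onD[OF 2 h2 xs])
  finally show ?thesis
    by (simp only: sgn scale_scale of_int_mult)
qed

section \<open>Unshuffles as coset representatives\<close>

lemma unshuffles_two_iff:
  "\<sigma> \<in> unshuffles [p, q] \<longleftrightarrow> \<sigma> permutes {..<p + q} \<and>
     strict_mono_on {..<p} \<sigma> \<and> strict_mono_on {p..<p + q} \<sigma>"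
proof -
  have "(\<forall>i<length [p, q]. P i) \<longleftrightarrow> P 0 \<and> P 1" for P :: "nat \<Rightarrow> bool"
    by (auto simp: less_Suc_eq)
  then show ?thesis
    unfolding unshuffles_def by (simp add: block_start_def lessThan_atLeast0)
qed

lemma finite_unshuffles [simp]: "finite (unshuffles rs)"
  by (rule finite_subset[OF _ finite_permutations[of "{..<sum_list rs}"]])
    (auto simp: unshuffles_def)

lemma unshuffles_ltD: "\<sigma> \<in> unshuffles_lt rs \<Longrightarrow> \<sigma> \<in> unshuffles rs"
  by (simp add: unshuffles_lt_def)

lemma unshufflesD: "\<sigma> \<in> unshuffles rs \<Longrightarrow> \<sigma> permutes {..<sum_list rs}"
  by (simp add: unshuffles_def)

text \<open>Both maps list the same finite set in increasing order, and a strictly sorted list is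
  determined by its set.\<close>

lemma strict_mono_on_image_unique:
  fixes u u' :: "nat \<Rightarrow> nat"
  assumes "strict_mono_on {a..<b} u" "strict_mono_on {a..<b} u'" "u ` {a..<b} = u' ` {a..<b}"
    and "i \<in> {a..<b}"
  shows "u i = u' i"
proof -
  have "sorted_wrt (<) (map v [a..<b])" if "strict_mono_on {a..<b} v" for v :: "nat \<Rightarrow> nat"
    unfolding sorted_wrt_iff_nth_less using strict_mono_onD[OF that] by simp
  then have "map u [a..<b] = map u' [a..<b]"
    using assms by (intro strict_sorted_equal) auto
  then show ?thesis
    using assms(4) by simp
qed

lemma permutes_image_block:
  fixes u :: "nat \<Rightarrow> nat"
  assumes "u permutes {..<p + q}"
  shows "u ` {p..<p + q} = {..<p + q} - u ` {..<p}"
proof -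
  have "{p..<p + q} = {..<p + q} - {..<p}"
    by auto
  then show ?thesis
    using permutes_image[OF assms] image_set_diff[OF permutes_inj[OF assms]] by metis
qed

text \<open>The image of the first block fixes that of the second as its complement, and on each
  block there is only one increasing enumeration. Together with \<open>unshuffles_two_exists\<close>
  this identifies unshuffles with \<open>p\<close>-element subsets, that is, with left cosets of S_p
  x S_q.\<close>

lemma unshuffles_two_unique:
  assumes u: "u \<in> unshuffles [p, q]" and u': "u' \<in> unshuffles [p, q]"
    and eq: "u ` {..<p} = u' ` {..<p}"
  shows "u = u'"
proof
  fix i
  note u = u[unfolded unshuffles_two_iff] and u' = u'[unfolded unshuffles_two_iff]
  have eq': "u ` {p..<p + q} = u' ` {p..<p + q}"
    using u u' eq by (simp add: permutes_image_block)
  consider "i < p" | "p \<le> i" "i < p + q" | "p + q \<le> i"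
    by linarith
  then show "u i = u' i"
  proof cases
    case 1
    then show ?thesis
      using u u' eq strict_mono_on_image_unique[of 0 p u u' i] by (simp add: lessThan_atLeast0)
  next
    case 2
    then show ?thesis
      using u u' eq' strict_mono_on_image_unique[of p "p + q" u u' i] by simp
  next
    case 3
    then show ?thesis
      using u u' by (metis lessThan_iff not_less permutes_not_in)
  qed
qed

text \<open>The witness lists \<open>A\<close> in increasing order and then its complement.\<close>

lemma unshuffles_two_exists:
  assumes A: "A \<subseteq> {..<p + q}" "card A = p"
  obtains u where "u \<in> unshuffles [p, q]" "u ` {..<p} = A"
proof -
  define B where "B = {..<p + q} - A"
  have fin: "finite A" "finite B"
    using A finite_subset by (auto simp: B_def)
  have card: "card B = q"
    using A by (simp add: B_def card_Diff_subset finite_subset)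
  define as where "as = sorted_list_of_set A"
  define bs where "bs = sorted_list_of_set B"
  have len: "length as = p" "length bs = q"
    using A card by (simp_all add: as_def bs_def)
  have set: "set as = A" "set bs = B"
    using fin by (simp_all add: as_def bs_def)
  have srt: "sorted_wrt (<) as" "sorted_wrt (<) bs"
    by (simp_all add: as_def bs_def)
  define u where "u i = (if i < p + q then (as @ bs) ! i else i)" for i
  have "distinct (as @ bs)"
    using fin by (auto simp: as_def bs_def B_def)
  then have "inj_on u {..<p + q}"
    using len by (auto simp: inj_on_def u_def nth_eq_iff_index_eq)
  moreover have "u i < p + q" if "i < p + q" for i
  proof -
    have "(as @ bs) ! i \<in> set (as @ bs)"
      using that len by (intro nth_mem) simp
    also have "\<dots> = {..<p + q}"
      using set A by (auto simp: B_def)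
    finally show ?thesis using that by (simp add: u_def)
  qed
  ultimately have perm: "u permutes {..<p + q}"
    by (intro inj_imp_permutes) (auto simp: u_def)
  have as: "u i = as ! i" if "i < p" for i
    using that len by (simp add: u_def nth_append)
  have bs: "u i = bs ! (i - p)" if "p \<le> i" "i < p + q" for i
    using that len by (simp add: u_def nth_append)
  have "strict_mono_on {..<p} u"
    using srt(1) len as by (auto simp: strict_mono_on_def sorted_wrt_iff_nth_less)
  moreover have "strict_mono_on {p..<p + q} u"
    using srt(2) len bs by (auto simp: strict_mono_on_def sorted_wrt_iff_nth_less)
  moreover have "u ` {..<p} = A"
    using as set(1) len(1) by (auto simp: set_conv_nth image_iff) 
  ultimately show ?thesis
    using perm that by (simp add: unshuffles_two_iff)
qed

text \<open>The signed summand \<open>\<phi>\<close> is constant on left cosets of S_p x S_q: a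
  factor from this subgroup contributes its sign once through \<open>sign\<close> and once through
  the skewness of \<open>F\<close>. Left multiplication by \<open>\<pi>\<close> permutes the cosets,
  so it only reorders the sum, up to the overall sign of \<open>\<pi>\<close>.\<close>

lemma skew_on_sgn_sum_unshuffles:
  assumes s: "vector_space s"
    and 1: "skew_on s (p + q) {..<p} F" and 2: "skew_on s (p + q) {p..<p + q} F"
  shows "skew_on s (p + q) {..<p + q} (sgn_sum s (unshuffles [p, q]) F)"
  unfolding skew_on_def
proof (intro allI impI)
  fix \<pi> and xs :: "'c list"
  assume \<pi>: "\<pi> permutes {..<p + q}" and xs: "length xs = p + q"
  interpret vector_space s by fact
  let ?U = "unshuffles [p, q]"
  define \<phi> where "\<phi> \<sigma> = s (of_int (sign \<sigma>)) (F (permute_list \<sigma> xs))" for \<sigma>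
  have perm: "u permutes {..<p + q}" if "u \<in> ?U" for u
    using that by (simp add: unshuffles_two_iff)
  \<comment> \<open>The product of \<open>\<pi>\<close> with an unshuffle is usually not an
    unshuffle; \<open>r u\<close> will be the unshuffle in its coset.\<close>
  have "\<exists>r. r \<in> ?U \<and> r ` {..<p} = (\<pi> \<circ> u) ` {..<p}" if "u \<in> ?U" for u
  proof -
    have p: "\<pi> \<circ> u permutes {..<p + q}"
      using permutes_compose[OF perm[OF that] \<pi>] .
    have "(\<pi> \<circ> u) ` {..<p} \<subseteq> (\<pi> \<circ> u) ` {..<p + q}"
      by (intro image_mono) auto
    then have "(\<pi> \<circ> u) ` {..<p} \<subseteq> {..<p + q}"
      using permutes_image[OF p] by simp
    moreover have "card ((\<pi> \<circ> u) ` {..<p}) = card {..<p}"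
      by (rule card_image[OF permutes_inj_on[OF p]])
    ultimately show ?thesis
      by (metis unshuffles_two_exists card_lessThan)
  qed
  then obtain r where r: "r u \<in> ?U" "r u ` {..<p} = (\<pi> \<circ> u) ` {..<p}" if "u \<in> ?U" for u
    by metis
  have "inj_on r ?U"
  proof (rule inj_onI)
    fix u u' assume u: "u \<in> ?U" "u' \<in> ?U" "r u = r u'"
    then have "\<pi> ` u ` {..<p} = \<pi> ` u' ` {..<p}"
      using r by (metis image_comp)
    then have "u ` {..<p} = u' ` {..<p}"
      using permutes_inj[OF \<pi>] by (simp add: inj_image_eq_iff)
    then show "u = u'"
      using u unshuffles_two_unique by blast
  qed
  then have bij: "bij_betw r ?U ?U"
    using r(1) endo_inj_surj[of ?U r] by (auto simp: bij_betw_def)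
  have \<phi>: "\<phi> (\<pi> \<circ> u) = \<phi> (r u)" if u: "u \<in> ?U" for u
  proof -
    \<comment> \<open>The element of S_p x S_q by which \<open>\<pi> \<circ> u\<close> differs from
      its representative.\<close>
    define h where "h = inv (r u) \<circ> (\<pi> \<circ> u)"
    note pr = perm[OF r(1)[OF u]]
    have p: "\<pi> \<circ> u permutes {..<p + q}"
      using permutes_compose[OF perm[OF u] \<pi>] .
    have h: "h permutes {..<p + q}"
      unfolding h_def by (rule permutes_compose[OF p permutes_inv[OF pr]])
    have "h ` {..<p} = inv (r u) ` (r u ` {..<p})"
      unfolding h_def image_comp[symmetric] using r(2)[OF u] by (simp add: image_comp)
    also have "\<dots> = {..<p}"
      using permutes_inj[OF pr] by (simp add: image_comp)
    finally have hp: "h ` {..<p} = {..<p}" .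
    have eq: "\<pi> \<circ> u = r u \<circ> h"
      unfolding h_def using permutes_inv_o(1)[OF pr] by (simp add: o_assoc)
    have "F (permute_list (r u \<circ> h) xs) = s (of_int (sign h)) (F (permute_list (r u) xs))"
      using skew_on_blocks[OF s 1 2 h hp, of "permute_list (r u) xs"] xs h
      by (simp add: permute_list_compose)
    moreover have "sign (r u \<circ> h) = sign (r u) * sign h"
      by (rule sign_compose_permutes[OF pr h]) auto
    ultimately show ?thesis
      unfolding \<phi>_def eq by simp
  qed
  have "sgn_sum s ?U F (permute_list \<pi> xs) = (\<Sum>u\<in>?U. s (of_int (sign \<pi>)) (\<phi> (\<pi> \<circ> u)))"
    unfolding sgn_sum_def
  proof (rule sum.cong)
    fix u assume "u \<in> ?U"
    note u = perm[OF this]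
    have "sign (\<pi> \<circ> u) = sign \<pi> * sign u"
      by (rule sign_compose_permutes[OF \<pi> u]) auto
    then show "s (of_int (sign u)) (F (permute_list u (permute_list \<pi> xs))) =
        s (of_int (sign \<pi>)) (\<phi> (\<pi> \<circ> u))"
      unfolding \<phi>_def using u xs by (simp add: permute_list_compose)
  qed simp
  also have "\<dots> = s (of_int (sign \<pi>)) (\<Sum>u\<in>?U. \<phi> (r u))"
    using \<phi> by (simp add: scale_sum_right)
  also have "(\<Sum>u\<in>?U. \<phi> (r u)) = (\<Sum>u\<in>?U. \<phi> u)"
    by (rule sum.reindex_bij_betw[OF bij])
  finally show "sgn_sum s ?U F (permute_list \<pi> xs) = s (of_int (sign \<pi>)) (sgn_sum s ?U F xs)"
    by (simp add: sgn_sum_def \<phi>_def)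
qed

section \<open>Multilinear maps\<close>

text \<open>The half of \<open>multilinear_maps\<close> that survives composition: it is silent on
  lists of the wrong length, where composites need not vanish.\<close>

definition multilinear_on ::
  "('k::field \<Rightarrow> 'a::ab_group_add \<Rightarrow> 'a) \<Rightarrow> ('k \<Rightarrow> 'b::ab_group_add \<Rightarrow> 'b) \<Rightarrow> nat \<Rightarrow>
   ('a list \<Rightarrow> 'b) \<Rightarrow> bool" where
  "multilinear_on s s' n F \<longleftrightarrow> (\<forall>xs i. length xs = n \<longrightarrow> i < n \<longrightarrow>
     Vector_Spaces.linear s s' (\<lambda>x. F (xs[i := x])))"

lemma multilinear_onD:
  "multilinear_on s s' n F \<Longrightarrow> length xs = n \<Longrightarrow> i < n \<Longrightarrow>
    Vector_Spaces.linear s s' (\<lambda>x. F (xs[i := x]))"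
  by (simp add: multilinear_on_def)

lemma multilinear_maps_iff:
  "F \<in> multilinear_maps s s' n \<longleftrightarrow>
    multilinear_on s s' n F \<and> (\<forall>xs. length xs \<noteq> n \<longrightarrow> F xs = 0)"
  by (auto simp: multilinear_maps_def multilinear_on_def)

lemma skew_maps_iff:
  "F \<in> skew_maps s s' n \<longleftrightarrow>
    multilinear_on s s' n F \<and> skew_on s' n {..<n} F \<and> (\<forall>xs. length xs \<noteq> n \<longrightarrow> F xs = 0)"
  by (auto simp: skew_maps_def multilinear_maps_iff skew_on_def)

lemma linear_at_zero: "Vector_Spaces.linear s s' f \<Longrightarrow> f 0 = 0"
  by (metis module_hom.zero module_hom_iff_linear)

lemma multilinear_on_zero_entry:
  assumes "multilinear_on s s' n F" "length xs = n" "0 \<in> set xs"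
  shows "F xs = 0"
proof -
  obtain i where i: "i < n" "xs ! i = 0"
    using assms(2,3) by (metis in_set_conv_nth)
  have "xs[i := 0] = xs"
    using i(2) list_update_id by metis
  then show ?thesis
    using linear_at_zero[OF multilinear_onD[OF assms(1,2) i(1)]] by simp
qed

text \<open>The length of \<open>xs\<close> is free: a list of the right length is covered by
  linearity, any other list by the normalisation.\<close>

lemma multilinear_maps_zero_entry:
  assumes "F \<in> multilinear_maps s s' n" "0 \<in> set xs"
  shows "F xs = 0"
  using assms multilinear_on_zero_entry by (metis multilinear_maps_iff)

lemma multilinear_on_cong:
  assumes "multilinear_on s s' n F" "\<And>xs. length xs = n \<Longrightarrow> G xs = F xs"
  shows "multilinear_on s s' n G"
  unfolding multilinear_on_def
proof (intro allI impI)
  fix xs :: "'b list" and i assume xs: "length xs = n" "i < n"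
  have "(\<lambda>x. G (xs[i := x])) = (\<lambda>x. F (xs[i := x]))"
    using xs by (intro ext assms(2)) simp
  then show "Vector_Spaces.linear s s' (\<lambda>x. G (xs[i := x]))"
    using multilinear_onD[OF assms(1) xs] by simp
qed

lemma skew_on_cong:
  assumes "skew_on s n A F" "\<And>xs. length xs = n \<Longrightarrow> G xs = F xs"
  shows "skew_on s n A G"
  unfolding skew_on_def using skew_onD[OF assms(1)] assms(2) by (metis length_permute_list)

lemma multilinear_on_0:
  assumes "vector_space s" "vector_space s'"
  shows "multilinear_on s s' n (\<lambda>_. 0)"
  using assms module_hom_iff_linear module_iff_vector_space module_pair.intro
    module_pair.module_hom_zero
  unfolding multilinear_on_def by metis

lemma linear_add:
  "Vector_Spaces.linear s s' f \<Longrightarrow> Vector_Spaces.linear s s' g \<Longrightarrow>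
    Vector_Spaces.linear s s' (\<lambda>x. f x + g x)"
  unfolding module_hom_iff_linear[symmetric]
  by (rule module_pair.module_hom_add) (auto intro: module_pair.intro dest: module_hom.axioms)

lemma linear_scale:
  "Vector_Spaces.linear s s' f \<Longrightarrow> Vector_Spaces.linear s s' (\<lambda>x. s' c (f x))"
  unfolding module_hom_iff_linear[symmetric]
  by (rule module_pair.module_hom_scale) (auto intro: module_pair.intro dest: module_hom.axioms)

lemma multilinear_on_add:
  assumes "multilinear_on s s' n F" "multilinear_on s s' n G"
  shows "multilinear_on s s' n (\<lambda>xs. F xs + G xs)"
  using assms linear_add unfolding multilinear_on_def by blast

lemma multilinear_on_scale:
  assumes "multilinear_on s s' n F"
  shows "multilinear_on s s' n (\<lambda>xs. s' c (F xs))"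
  using assms linear_scale unfolding multilinear_on_def by blast

lemma multilinear_on_sum:
  assumes s: "vector_space s" "vector_space s'"
    and F: "\<And>a. a \<in> S \<Longrightarrow> multilinear_on s s' n (F a)"
  shows "multilinear_on s s' n (\<lambda>xs. \<Sum>a\<in>S. F a xs)"
  using F
proof (induction S rule: infinite_finite_induct)
  case (insert a S)
  then show ?case
    using multilinear_on_add[of s s' n "F a" "\<lambda>xs. \<Sum>a\<in>S. F a xs"] by simp
qed (simp_all add: multilinear_on_0[OF s])

lemma multilinear_on_permute_list:
  assumes F: "multilinear_on s s' n F" and \<sigma>: "\<sigma> permutes {..<n}"
  shows "multilinear_on s s' n (\<lambda>xs. F (permute_list \<sigma> xs))"
  unfolding multilinear_on_def
proof (intro allI impI)
  fix xs :: "'b list" and i assume xs: "length xs = n" and i: "i < n"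
  have j: "inv \<sigma> i < n"
    using permutes_in_image[OF permutes_inv[OF \<sigma>], of i] i by simp
  \<comment> \<open>Entry \<open>i\<close> of the original list sits at position
    \<open>inv \<sigma> i\<close> of the permuted one.\<close>
  have "permute_list \<sigma> (xs[i := x]) = (permute_list \<sigma> xs)[inv \<sigma> i := x]" for x
  proof (rule nth_equalityI)
    fix k assume "k < length (permute_list \<sigma> (xs[i := x]))"
    then have k: "k < n" using xs by simp
    moreover have "\<sigma> k < n"
      using permutes_in_image[OF \<sigma>, of k] k by simp
    moreover have "inv \<sigma> i = k \<longleftrightarrow> i = \<sigma> k"
      using permutes_inv_eq[OF \<sigma>] by metis
    ultimately show "permute_list \<sigma> (xs[i := x]) ! k = (permute_list \<sigma> xs)[inv \<sigma> i := x] ! k"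
      using xs \<sigma> i j by (simp add: permute_list_nth nth_list_update)
  qed simp
  then show "Vector_Spaces.linear s s' (\<lambda>x. F (permute_list \<sigma> (xs[i := x])))"
    using multilinear_onD[OF F _ j, of "permute_list \<sigma> xs"] xs by simp
qed

lemma multilinear_on_sgn_sum:
  assumes s: "vector_space s" "vector_space s'"
    and F: "multilinear_on s s' n F" and S: "\<And>\<sigma>. \<sigma> \<in> S \<Longrightarrow> \<sigma> permutes {..<n}"
  shows "multilinear_on s s' n (sgn_sum s' S F)"
proof -
  have "multilinear_on s s' n (\<lambda>xs. \<Sum>\<sigma>\<in>S. s' (of_int (sign \<sigma>)) (F (permute_list \<sigma> xs)))"
    by (intro multilinear_on_sum s multilinear_on_scale multilinear_on_permute_list F S)
  then show ?thesis
    by (rule multilinear_on_cong) (simp add: sgn_sum_def)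
qed

lemma skew_on_0: "vector_space s \<Longrightarrow> skew_on s n A (\<lambda>_. 0)"
  by (simp add: skew_on_def module.scale_zero_right module_iff_vector_space)

lemma skew_on_add:
  assumes "vector_space s" "skew_on s n A F" "skew_on s n A G"
  shows "skew_on s n A (\<lambda>xs. F xs + G xs)"
proof -
  interpret vector_space s by fact
  show ?thesis
    using assms(2,3) by (simp add: skew_on_def scale_right_distrib)
qed

lemma skew_on_scale:
  assumes "vector_space s" "skew_on s n A F"
  shows "skew_on s n A (\<lambda>xs. s c (F xs))"
proof -
  interpret vector_space s by fact
  show ?thesis
    using assms(2) by (simp add: skew_on_def mult.commute)
qed

lemma multilinear_on_circ1:
  assumes X: "multilinear_on s s' (Suc q) X" and Y: "multilinear_on s s p Y"
  shows "multilinear_on s s' (p + q) (circ1 p X Y)"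
  unfolding multilinear_on_def
proof (intro allI impI)
  fix xs :: "'b list" and i assume xs: "length xs = p + q" and i: "i < p + q"
  show "Vector_Spaces.linear s s' (\<lambda>x. circ1 p X Y (xs[i := x]))"
  proof (cases "i < p")
    case True
    \<comment> \<open>The leading \<open>0\<close> is a placeholder that the update overwrites; it
      gives the list the length required by the multilinearity of \<open>X\<close>.\<close>
    have "Vector_Spaces.linear s s'
        ((\<lambda>y. X ((0 # drop p xs)[0 := y])) \<circ> (\<lambda>x. Y ((take p xs)[i := x])))"
      using xs True by (intro Vector_Spaces.linear_compose[OF multilinear_onD[OF Y] multilinear_onD[OF X]]) simp_all
    then show ?thesis
      using True by (simp add: circ1_def o_def take_update_swap)
  next
    case False
    have "Vector_Spaces.linear s s' (\<lambda>x. X ((Y (take p xs) # drop p xs)[Suc (i - p) := x]))"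
      using xs False i by (intro multilinear_onD[OF X]) simp_all
    then show ?thesis
      using False by (simp add: circ1_def drop_update_swap)
  qed
qed

text \<open>A swap within the first \<open>p\<close> inputs changes the sign of the value of
  \<open>Y\<close>, and linearity of \<open>X\<close> in its first slot carries the sign outside. A
  swap behind them is a swap of two inputs of \<open>X\<close>, whose positions are shifted by the
  single slot that \<open>Y\<close> occupies.\<close>

lemma skew_on_circ1:
  assumes s: "vector_space s" "vector_space s'" and X: "multilinear_on s s' (Suc q) X" "skew_on s' (Suc q) {..<Suc q} X"
    and Y: "skew_on s p {..<p} Y"
  shows "skew_on s' (p + q) {..<p} (circ1 p X Y)"
    and "skew_on s' (p + q) {p..<p + q} (circ1 p X Y)"
proof -
  show "skew_on s' (p + q) {..<p} (circ1 p X Y)"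
  proof (rule skew_on_transposeI[OF s(2)])
    fix a b and xs :: "'b list"
    assume ab: "a \<in> {..<p}" "b \<in> {..<p}" "a \<noteq> b" and xs: "length xs = p + q"
    have "Vector_Spaces.linear s s' (\<lambda>y. X ((0 # drop p xs)[0 := y]))"
      using xs by (intro multilinear_onD[OF X(1)]) simp_all
    then have "X (- y # drop p xs) = - X (y # drop p xs)" for y
      using module_hom.neg[of s s' "\<lambda>y. X (y # drop p xs)" y] by (simp add: module_hom_iff_linear)
    moreover have "Y (permute_list (transpose a b) (take p xs)) = - Y (take p xs)"
      using xs by (intro skew_on_transposeD[OF s(1) Y ab]) simp
    moreover note take_drop_permute_list[OF permutes_swap_id[OF ab(1,2)], of xs]
    ultimately show "circ1 p X Y (permute_list (transpose a b) xs) = - circ1 p X Y xs"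
      using xs by (simp add: circ1_def)
  qed auto
  show "skew_on s' (p + q) {p..<p + q} (circ1 p X Y)"
  proof (rule skew_on_transposeI[OF s(2)])
    fix a b and xs :: "'b list"
    assume ab: "a \<in> {p..<p + q}" "b \<in> {p..<p + q}" "a \<noteq> b" and xs: "length xs = p + q"
    have "Y (take p xs) # permute_list (transpose (a - p) (b - p)) (drop p xs) =
        permute_list (transpose (Suc (a - p)) (Suc (b - p))) (Y (take p xs) # drop p xs)"
      using append_permute_list_transpose[of "a - p" "drop p xs" "b - p" "[Y (take p xs)]"] ab xs
      by auto
    moreover have "X (permute_list (transpose (Suc (a - p)) (Suc (b - p))) (Y (take p xs) # drop p xs)) =
        - X (Y (take p xs) # drop p xs)"
      using ab xs by (intro skew_on_transposeD[OF s(2) X(2)]) auto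
    moreover note take_drop_permute_list_transpose[of p a b xs]
    ultimately show "circ1 p X Y (permute_list (transpose a b) xs) = - circ1 p X Y xs"
      using xs ab by (simp add: circ1_def)
  qed auto
qed

section \<open>Composites with tensor products\<close>

text \<open>The elimination device for graphs: a vertex decorated by zero puts a zero among the
  arguments of the root, and a multilinear root then gives \<open>0\<close>.\<close>

lemma tensor_zero_entry: "(r, \<lambda>_. 0) \<in> set Fs \<Longrightarrow> 0 \<in> set (tensor Fs xs)"
proof (induction Fs arbitrary: xs)
  case (Cons F Fs)
  then show ?case by (cases F) auto
qed simp

lemma tensor_replicate_append:
  "n \<le> length xs \<Longrightarrow>
    tensor (replicate n (1, unary g) @ Fs) xs = map g (take n xs) @ tensor Fs (drop n xs)"
proof (induction n arbitrary: xs)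
  case (Suc n)
  then show ?case by (cases xs) (auto simp: unary_def)
qed simp

lemma tensor_map_ones:
  "length is = length xs \<Longrightarrow>
    tensor (map (\<lambda>i. (1, G i)) is) xs = map (\<lambda>(i, x). G i [x]) (zip is xs)"
  by (induction "is" xs rule: list_induct2) auto

lemma comp_tensor_ones:
  "length xs = n + m \<Longrightarrow>
    comp_tensor X (replicate n (1, unary g) @ [(m, Y)]) xs = X (map g (take n xs) @ [Y (drop n xs)])"
  using tensor_replicate_append[of n xs g "[(m, Y)]"] by (simp add: comp_tensor_def)

lemma comp_tensor_binary:
  "length xs = n + m \<Longrightarrow>
    comp_tensor (binary b) [(n, Y), (m, Z)] xs = b (Y (take n xs)) (Z (drop n xs))"
  by (simp add: comp_tensor_def binary_def)

lemma linear_uminus: "Vector_Spaces.linear s s' f \<Longrightarrow> f (- x) = - f x"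
  by (metis module_hom.neg module_hom_iff_linear)

lemma multilinear_on_comp_tensor_ones:
  assumes X: "multilinear_on s' s'' (Suc n) X" and Y: "multilinear_on s s' m Y"
    and g: "Vector_Spaces.linear s s' g"
  shows "multilinear_on s s'' (n + m) (comp_tensor X (replicate n (1, unary g) @ [(m, Y)]))"
proof (rule multilinear_on_cong[OF _ comp_tensor_ones])
  show "multilinear_on s s'' (n + m) (\<lambda>xs. X (map g (take n xs) @ [Y (drop n xs)]))"
    unfolding multilinear_on_def
  proof (intro allI impI)
    fix xs :: "'d list" and i assume xs: "length xs = n + m" and i: "i < n + m"
    show "Vector_Spaces.linear s s''
        (\<lambda>x. X (map g (take n (xs[i := x])) @ [Y (drop n (xs[i := x]))]))"
    proof (cases "i < n")
      case True
      have "Vector_Spaces.linear s s''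
          ((\<lambda>y. X ((map g (take n xs) @ [Y (drop n xs)])[i := y])) \<circ> g)"
        using xs True by (intro Vector_Spaces.linear_compose[OF g multilinear_onD[OF X]]) simp_all
      then show ?thesis
        using True xs by (simp add: o_def take_update_swap map_update list_update_append)
    next
      case False
      have "Vector_Spaces.linear s s''
          ((\<lambda>y. X ((map g (take n xs) @ [0])[n := y])) \<circ> (\<lambda>x. Y ((drop n xs)[i - n := x])))"
        using xs False i
        by (intro Vector_Spaces.linear_compose[OF multilinear_onD[OF Y] multilinear_onD[OF X]]) simp_all
      then show ?thesis
        using False xs by (simp add: o_def drop_update_swap list_update_append)
    qed
  qed
qed

text \<open>Equal factors \<open>g\<close> make a swap of two of the first \<open>n\<close> inputs a
  swap of two arguments of \<open>X\<close>. In the last block the sign comes from \<open>Y\<close>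
  and passes through the last slot of \<open>X\<close> by linearity.\<close>

lemma skew_on_comp_tensor_ones:
  assumes s: "vector_space s'" "vector_space s''"
    and X: "multilinear_on s' s'' (Suc n) X" "skew_on s'' (Suc n) {..<Suc n} X"
    and Y: "skew_on s' m {..<m} Y"
  shows "skew_on s'' (n + m) {..<n} (comp_tensor X (replicate n (1, unary g) @ [(m, Y)]))"
    and "skew_on s'' (n + m) {n..<n + m} (comp_tensor X (replicate n (1, unary g) @ [(m, Y)]))"
proof -
  show "skew_on s'' (n + m) {..<n} (comp_tensor X (replicate n (1, unary g) @ [(m, Y)]))"
  proof (rule skew_on_cong[OF _ comp_tensor_ones], rule skew_on_transposeI[OF s(2)])
    fix a b and xs :: "'d list"
    assume ab: "a \<in> {..<n}" "b \<in> {..<n}" "a \<noteq> b" and xs: "length xs = n + m"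
    let ?t = "transpose a b"
    note t = permutes_swap_id[OF ab(1,2)]
    have "map g (take n (permute_list ?t xs)) = permute_list ?t (map g (take n xs))"
      using take_drop_permute_list(1)[OF t, of xs] permute_list_map[of ?t "take n xs" g] t xs
      by (simp add: min_def)
    moreover have "permute_list ?t (map g (take n xs)) @ [y] =
        permute_list ?t (map g (take n xs) @ [y])" for y
      using permute_list_append[of ?t "map g (take n xs)" "[y]"] t xs by (simp add: min_def)
    moreover have "X (permute_list ?t (map g (take n xs) @ [y])) = - X (map g (take n xs) @ [y])" for y
      using xs ab by (intro skew_on_transposeD[OF s(2) X(2)]) auto
    moreover note take_drop_permute_list(2)[OF t, of xs]
    ultimately show "X (map g (take n (permute_list ?t xs)) @ [Y (drop n (permute_list ?t xs))]) =
        - X (map g (take n xs) @ [Y (drop n xs)])"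
      using xs by simp
  qed auto
  show "skew_on s'' (n + m) {n..<n + m} (comp_tensor X (replicate n (1, unary g) @ [(m, Y)]))"
  proof (rule skew_on_cong[OF _ comp_tensor_ones], rule skew_on_transposeI[OF s(2)])
    fix a b and xs :: "'d list"
    assume ab: "a \<in> {n..<n + m}" "b \<in> {n..<n + m}" "a \<noteq> b" and xs: "length xs = n + m"
    have "Vector_Spaces.linear s' s'' (\<lambda>y. X ((map g (take n xs) @ [0])[n := y]))"
      using xs by (intro multilinear_onD[OF X(1)]) simp_all
    then have "X (map g (take n xs) @ [- y]) = - X (map g (take n xs) @ [y])" for y
      using linear_uminus[of s' s'' "\<lambda>y. X (map g (take n xs) @ [y])" y] xs
      by (simp add: list_update_append)
    moreover have "Y (permute_list (transpose (a - n) (b - n)) (drop n xs)) = - Y (drop n xs)"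
      using xs ab by (intro skew_on_transposeD[OF s(1) Y]) auto
    moreover note take_drop_permute_list_transpose[of n a b xs]
    ultimately show "X (map g (take n (permute_list (transpose a b) xs)) @
          [Y (drop n (permute_list (transpose a b) xs))]) =
        - X (map g (take n xs) @ [Y (drop n xs)])"
      using xs ab by simp
  qed auto
qed

lemma multilinear_on_comp_tensor_binary:
  assumes b: "\<And>x. Vector_Spaces.linear s' s'' (b x)" "\<And>y. Vector_Spaces.linear s' s'' (\<lambda>x. b x y)"
    and Y: "multilinear_on s s' n Y" and Z: "multilinear_on s s' m Z"
  shows "multilinear_on s s'' (n + m) (comp_tensor (binary b) [(n, Y), (m, Z)])"
proof (rule multilinear_on_cong[OF _ comp_tensor_binary])
  show "multilinear_on s s'' (n + m) (\<lambda>xs. b (Y (take n xs)) (Z (drop n xs)))"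
    unfolding multilinear_on_def
  proof (intro allI impI)
    fix xs :: "'d list" and i assume xs: "length xs = n + m" and i: "i < n + m"
    show "Vector_Spaces.linear s s'' (\<lambda>x. b (Y (take n (xs[i := x]))) (Z (drop n (xs[i := x]))))"
    proof (cases "i < n")
      case True
      have "Vector_Spaces.linear s s'' ((\<lambda>y. b y (Z (drop n xs))) \<circ> (\<lambda>x. Y ((take n xs)[i := x])))"
        using xs True by (intro Vector_Spaces.linear_compose[OF multilinear_onD[OF Y] b(2)]) simp_all
      then show ?thesis
        using True by (simp add: o_def take_update_swap)
    next
      case False
      have "Vector_Spaces.linear s s'' (b (Y (take n xs)) \<circ> (\<lambda>x. Z ((drop n xs)[i - n := x])))"
        using xs False i by (intro Vector_Spaces.linear_compose[OF multilinear_onD[OF Z] b(1)]) simp_all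
      then show ?thesis
        using False by (simp add: o_def drop_update_swap)
    qed
  qed
qed

lemma skew_on_comp_tensor_binary:
  assumes s: "vector_space s'" "vector_space s''"
    and b: "\<And>x. Vector_Spaces.linear s' s'' (b x)" "\<And>y. Vector_Spaces.linear s' s'' (\<lambda>x. b x y)"
    and Y: "skew_on s' n {..<n} Y" and Z: "skew_on s' m {..<m} Z"
  shows "skew_on s'' (n + m) {..<n} (comp_tensor (binary b) [(n, Y), (m, Z)])"
    and "skew_on s'' (n + m) {n..<n + m} (comp_tensor (binary b) [(n, Y), (m, Z)])"
proof -
  show "skew_on s'' (n + m) {..<n} (comp_tensor (binary b) [(n, Y), (m, Z)])"
  proof (rule skew_on_cong[OF _ comp_tensor_binary], rule skew_on_transposeI[OF s(2)])
    fix i j and xs :: "'d list"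
    assume ij: "i \<in> {..<n}" "j \<in> {..<n}" "i \<noteq> j" and xs: "length xs = n + m"
    have "Y (permute_list (transpose i j) (take n xs)) = - Y (take n xs)"
      using xs by (intro skew_on_transposeD[OF s(1) Y ij]) simp
    then show "b (Y (take n (permute_list (transpose i j) xs)))
          (Z (drop n (permute_list (transpose i j) xs))) =
        - b (Y (take n xs)) (Z (drop n xs))"
      using take_drop_permute_list[OF permutes_swap_id[OF ij(1,2)], of xs] xs
        linear_uminus[OF b(2)] by simp
  qed auto
  show "skew_on s'' (n + m) {n..<n + m} (comp_tensor (binary b) [(n, Y), (m, Z)])"
  proof (rule skew_on_cong[OF _ comp_tensor_binary], rule skew_on_transposeI[OF s(2)])
    fix i j and xs :: "'d list"
    assume ij: "i \<in> {n..<n + m}" "j \<in> {n..<n + m}" "i \<noteq> j" and xs: "length xs = n + m"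
    have "Z (permute_list (transpose (i - n) (j - n)) (drop n xs)) = - Z (drop n xs)"
      using xs ij by (intro skew_on_transposeD[OF s(1) Z]) auto
    then show "b (Y (take n (permute_list (transpose i j) xs)))
          (Z (drop n (permute_list (transpose i j) xs))) =
        - b (Y (take n xs)) (Z (drop n xs))"
      using take_drop_permute_list_transpose[of n i j xs] ij xs linear_uminus[OF b(1)] by simp
  qed auto
qed


section \<open>Sums over decorated graphs\<close>

text \<open>The form in which \<open>l_op\<close> evaluates a formal combination. Its additivity
  allows evaluation on the singletons that make up the differential, without asking which of these
  graphs coincide or cancel.\<close>

definition lin_ext ::
  "('k::field \<Rightarrow> 'b::ab_group_add \<Rightarrow> 'b) \<Rightarrow> ('a \<Rightarrow> 'b) \<Rightarrow> ('a \<Rightarrow>\<^sub>0 int) \<Rightarrow> 'b" where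
  "lin_ext s h P = (\<Sum>\<Gamma>\<in>Poly_Mapping.keys P. s (of_int (Poly_Mapping.lookup P \<Gamma>)) (h \<Gamma>))"

context vector_space
begin

text \<open>Keys may cancel in a difference; over a common finite superset the extra keys have
  coefficient zero, and the sums can be compared termwise.\<close>

lemma lin_ext_superset:
  assumes "finite K" "Poly_Mapping.keys P \<subseteq> K"
  shows "lin_ext scale h P = (\<Sum>\<Gamma>\<in>K. scale (of_int (Poly_Mapping.lookup P \<Gamma>)) (h \<Gamma>))"
  unfolding lin_ext_def using assms
  by (intro sum.mono_neutral_left) (auto simp: in_keys_iff)

lemma lin_ext_diff: "lin_ext scale h (P - Q) = lin_ext scale h P - lin_ext scale h Q"
proof -
  define K where "K = Poly_Mapping.keys P \<union> Poly_Mapping.keys Q"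
  have K: "finite K" "Poly_Mapping.keys P \<subseteq> K" "Poly_Mapping.keys Q \<subseteq> K"
    by (simp_all add: K_def)
  have K': "Poly_Mapping.keys (P - Q) \<subseteq> K"
    unfolding K_def by (rule keys_diff)
  show ?thesis
    unfolding lin_ext_superset[OF K(1,2)] lin_ext_superset[OF K(1,3)] lin_ext_superset[OF K(1) K']
    by (simp only: lookup_minus of_int_diff scale_left_diff_distrib sum_subtractf)
qed

lemma lin_ext_0 [simp]: "lin_ext scale h 0 = 0"
  by (simp add: lin_ext_def)

lemma lin_ext_add: "lin_ext scale h (P + Q) = lin_ext scale h P + lin_ext scale h Q"
  using lin_ext_diff[of h "P + Q" Q] by simp

lemma lin_ext_sum: "lin_ext scale h (\<Sum>a\<in>A. P a) = (\<Sum>a\<in>A. lin_ext scale h (P a))"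
  by (induction A rule: infinite_finite_induct) (simp_all add: lin_ext_add)

lemma lin_ext_single [simp]:
  "lin_ext scale h (Poly_Mapping.single \<Gamma> c) = scale (of_int c) (h \<Gamma>)"
  by (simp add: lin_ext_def)

end

section \<open>Pairs of vertices, and graphs with two vertices\<close>

lemma vertex_tuples_two:
  "vertex_tuples 2 A = (\<lambda>(a, b). [a, b]) ` (SIGMA a:A. A - {a})"
  by (force simp: vertex_tuples_def length_Suc_conv numeral_2_eq_2)

lemma vertex_tuples_two_01: "vertex_tuples 2 {0, 1} = {[0, 1], [1, 0]}"
  by (auto simp: vertex_tuples_two)

text \<open>Ordered pairs of distinct vertices are sorted by the place of the root: it carries the
  first cochain, the second, or neither.\<close>

lemma sum_vertex_tuples_two_atMost:
  fixes f :: "nat list \<Rightarrow> 'b::comm_monoid_add"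
  shows "(\<Sum>vs\<in>vertex_tuples 2 {..l}. f vs) =
    (\<Sum>i<l. f [0, Suc i]) + (\<Sum>i<l. f [Suc i, 0]) + (\<Sum>i<l. \<Sum>j\<in>{..<l} - {i}. f [Suc i, Suc j])"
proof -
  have atMost: "{..l} = insert 0 (Suc ` {..<l})"
    by (simp add: lessThan_Suc_eq_insert_0 flip: lessThan_Suc_atMost)
  have inj: "inj_on (\<lambda>(a, b). [a, b]) S" for S :: "(nat \<times> nat) set"
    by (auto simp: inj_on_def)
  have "(\<Sum>vs\<in>vertex_tuples 2 {..l}. f vs) = (\<Sum>a\<le>l. \<Sum>b\<in>{..l} - {a}. f [a, b])"
    unfolding vertex_tuples_two by (subst sum.reindex[OF inj]) (simp add: sum.Sigma case_prod_unfold)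
  also have "\<dots> = (\<Sum>b\<in>{..l} - {0}. f [0, b]) + (\<Sum>i<l. \<Sum>b\<in>{..l} - {Suc i}. f [Suc i, b])"
    by (simp add: sum.atMost_shift)
  also have "(\<Sum>b\<in>{..l} - {0}. f [0, b]) = (\<Sum>i<l. f [0, Suc i])"
  proof -
    have "{..l} - {0} = Suc ` {..<l}"
      unfolding atMost by auto
    then show ?thesis by (simp add: sum.reindex)
  qed
  also have "(\<Sum>i<l. \<Sum>b\<in>{..l} - {Suc i}. f [Suc i, b]) =
      (\<Sum>i<l. f [Suc i, 0] + (\<Sum>j\<in>{..<l} - {i}. f [Suc i, Suc j]))"
  proof (rule sum.cong)
    fix i
    have "{..l} - {Suc i} = insert 0 (Suc ` ({..<l} - {i}))"
      unfolding atMost by auto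
    then show "(\<Sum>b\<in>{..l} - {Suc i}. f [Suc i, b]) =
        f [Suc i, 0] + (\<Sum>j\<in>{..<l} - {i}. f [Suc i, Suc j])"
      by (simp add: sum.reindex)
  qed simp
  finally show ?thesis by (simp add: sum.distrib add.assoc)
qed

lemma sgn_sum_0: "vector_space s \<Longrightarrow> (\<And>xs. F xs = 0) \<Longrightarrow> sgn_sum s S F xs = 0"
  by (simp add: sgn_sum_def module.scale_zero_right module_iff_vector_space)

lemma circ1_zero_right: "X \<in> multilinear_maps s s' i \<Longrightarrow> circ1 j X (\<lambda>_. 0) xs = 0"
  by (simp add: circ1_def multilinear_maps_zero_entry)

lemma circ1_zero_left: "circ1 j (\<lambda>_. 0) Y xs = 0"
  by (simp add: circ1_def)

text \<open>The supports of \<open>X\<close> and \<open>Y\<close> leave only the index pair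
  \<open>(n, m)\<close>. The lower bound \<open>a\<close> is \<open>2\<close> for compositions of
  brackets and \<open>1\<close> for an \<open>f\<close> at the root; \<open>n\<close> and
  \<open>m\<close> are arities here, not degrees.\<close>

lemma sum_circ1:
  assumes s: "vector_space s'" and X: "\<And>i. X i \<in> multilinear_maps s s' i"
    and X0: "\<And>i. i \<noteq> n \<or> n < a \<Longrightarrow> X i = (\<lambda>_. 0)"
    and Y0: "\<And>j. j \<noteq> m \<or> m < 2 \<Longrightarrow> Y j = (\<lambda>_. 0)"
  shows "(\<Sum>(i, j)\<in>{(i, j). i + j = N + 1 \<and> a \<le> i \<and> 2 \<le> j}.
      s' (c i j) (sgn_sum s' (unshuffles [j, i - 1]) (circ1 j (X i) (Y j)) xs)) =
    (if N + 1 = n + m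
     then s' (c n m) (sgn_sum s' (unshuffles [m, n - 1]) (circ1 m (X n) (Y m)) xs) else 0)"
proof -
  interpret vector_space s' by fact
  let ?A = "{(i, j). i + j = N + 1 \<and> a \<le> i \<and> 2 \<le> j}"
  define f where
    "f i j = s' (c i j) (sgn_sum s' (unshuffles [j, i - 1]) (circ1 j (X i) (Y j)) xs)" for i j
  have fin: "finite ?A"
    by (rule finite_subset[of _ "{..N + 1} \<times> {..N + 1}"]) auto
  have f0: "f i j = 0" if "i \<noteq> n \<or> j \<noteq> m \<or> n < a \<or> m < 2" for i j
  proof -
    have "X i = (\<lambda>_. 0) \<or> Y j = (\<lambda>_. 0)"
      using that X0 Y0 by blast
    then have "circ1 j (X i) (Y j) ys = 0" for ys
      using circ1_zero_left circ1_zero_right[OF X] by metis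
    then show ?thesis
      unfolding f_def by (simp add: sgn_sum_0[OF s])
  qed
  have "(\<Sum>p\<in>?A. case p of (i, j) \<Rightarrow> f i j) = (\<Sum>p\<in>?A. if p = (n, m) then f n m else 0)"
    using f0 by (intro sum.cong) auto
  also have "\<dots> = (if (n, m) \<in> ?A then f n m else 0)"
    using fin by (rule sum.delta)
  \<comment> \<open>Membership of \<open>(n, m)\<close> also demands \<open>a \<le> n\<close> and
    \<open>2 \<le> m\<close>; where one of these fails, \<open>f n m\<close> is zero anyway.\<close>
  also have "\<dots> = (if N + 1 = n + m then f n m else 0)"
    using f0[of n m] by auto
  finally show ?thesis
    unfolding f_def .
qed

context vector_space
begin

lemma lin_ext_boundary_bracket:
  "lin_ext scale h (boundary_bracket N) =
    (\<Sum>(i, j)\<in>{(i, j). i + j = N + 1 \<and> 2 \<le> i \<and> 2 \<le> j}. scale ((-1) ^ (j * (i - 1)))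
       (\<Sum>\<sigma>\<in>unshuffles [j, i - 1]. scale (of_int (sign \<sigma>)) (h (Bracket_Graph i j \<sigma>))))"
  by (simp add: boundary_bracket_def lin_ext_sum case_prod_unfold scale_sum_right)

lemma lin_ext_boundary_f:
  "lin_ext scale h (boundary_f N) =
    (\<Sum>l=2..N. \<Sum>rs\<in>{rs. length rs = l \<and> 0 \<notin> set rs \<and> sum_list rs = N \<and> sorted rs}.
       scale ((-1) ^ (l * (l - 1) div 2 + (\<Sum>i=1..l-1. rs ! (i - 1) * (l - i))))
        (\<Sum>\<sigma>\<in>unshuffles_lt rs. scale (of_int (sign \<sigma>)) (h (Nu_Fs rs \<sigma>)))) -
    (\<Sum>(i, j)\<in>{(i, j). i + j = N + 1 \<and> 1 \<le> i \<and> 2 \<le> j}. scale ((-1) ^ (j * (i - 1)))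
       (\<Sum>\<sigma>\<in>unshuffles [j, i - 1]. scale (of_int (sign \<sigma>)) (h (F_Mu i j \<sigma>))))"
  by (simp add: boundary_f_def lin_ext_diff lin_ext_sum case_prod_unfold scale_sum_right)

end

text \<open>With two vertices there are two placements, one for each choice of the cochain at the
  root. \<open>D\<close> abstracts from the colour, so the same computation serves the values on the
  \<open>\<mu>\<close> and on the \<open>\<nu>\<close> generators.\<close>

lemma bracket_graph_sum:
  fixes D :: "nat list \<Rightarrow> nat \<Rightarrow> nat \<Rightarrow> 'a::ab_group_add list \<Rightarrow> 'a"
  assumes s: "vector_space s"
    and T: "\<And>k. T k \<in> multilinear_maps s s k" "\<And>k. k \<noteq> n + 1 \<or> n + 1 < 2 \<Longrightarrow> T k = (\<lambda>_. 0)"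
    and W: "\<And>k. W k \<in> multilinear_maps s s k" "\<And>k. k \<noteq> m + 1 \<or> m + 1 < 2 \<Longrightarrow> W k = (\<lambda>_. 0)"
    and D: "D [0, 1] 0 = T" "D [0, 1] 1 = W" "D [1, 0] 0 = W" "D [1, 0] 1 = T"
  shows "lin_ext s (\<lambda>\<Gamma>. \<Sum>vs\<in>vertex_tuples 2 (vertices_bracket \<Gamma>). gamma_bracket (D vs) \<Gamma> xs)
      (boundary_bracket N) =
    (if N = n + m + 1
     then s ((-1) ^ ((m + 1) * n)) (sgn_sum s (unshuffles [m + 1, n]) (circ1 (m + 1) (T (n + 1)) (W (m + 1))) xs)
        + s ((-1) ^ ((n + 1) * m)) (sgn_sum s (unshuffles [n + 1, m]) (circ1 (n + 1) (W (m + 1)) (T (n + 1))) xs)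
     else 0)"
proof -
  interpret vector_space s by fact
  have "(\<Sum>\<sigma>\<in>unshuffles [j, i - 1]. s (of_int (sign \<sigma>))
        (\<Sum>vs\<in>vertex_tuples 2 (vertices_bracket (Bracket_Graph i j \<sigma>)).
           gamma_bracket (D vs) (Bracket_Graph i j \<sigma>) xs)) =
      sgn_sum s (unshuffles [j, i - 1]) (circ1 j (T i) (W j)) xs +
      sgn_sum s (unshuffles [j, i - 1]) (circ1 j (W i) (T j)) xs" for i j
    unfolding vertices_bracket.simps vertex_tuples_two_01
    by (simp add: D[unfolded One_nat_def] sgn_sum_def scale_right_distrib sum.distrib)
  note * = this
  note 1 = sum_circ1[where X = T and Y = W and n = "n + 1" and m = "m + 1" and N = N and xs = xs and a = 2 and c = "\<lambda>i j. (-1) ^ (j * (i - 1))", OF s T(1,2) W(2)]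
  note 2 = sum_circ1[where X = W and Y = T and n = "m + 1" and m = "n + 1" and N = N and xs = xs and a = 2 and c = "\<lambda>i j. (-1) ^ (j * (i - 1))", OF s W(1,2) T(2)]
  show ?thesis
    unfolding lin_ext_boundary_bracket * scale_right_distrib sum.distrib
    using 1 2 by (simp add: case_prod_unfold scale_right_distrib sum.distrib add.commute)
qed

section \<open>Graphs with a \<open>\<nu>\<close> at the root\<close>

text \<open>The decoration \<open>H\<close> depends on the position as well as the arity, so that
  one factor can carry a cochain while others of the same arity carry the morphism.\<close>

definition nu_term ::
  "(nat \<Rightarrow> 'v::ab_group_add list \<Rightarrow> 'v) \<Rightarrow> (nat \<Rightarrow> nat \<Rightarrow> 'u list \<Rightarrow> 'v) \<Rightarrow> nat list \<Rightarrow> 'u list \<Rightarrow> 'v"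
  where "nu_term X H rs =
    comp_tensor (X (length rs)) (map (\<lambda>k. (rs ! k, H k (rs ! k))) [0..<length rs])"

lemma nu_term_zero:
  assumes "X (length rs) \<in> multilinear_maps s s' (length rs)" "k < length rs" "H k (rs ! k) = (\<lambda>_. 0)"
  shows "nu_term X H rs ys = 0"
proof -
  have "(rs ! k, \<lambda>_. 0) \<in> set (map (\<lambda>k. (rs ! k, H k (rs ! k))) [0..<length rs])"
    using assms(2,3) by (force simp: image_iff)
  then show ?thesis
    unfolding nu_term_def comp_tensor_def
    by (intro multilinear_maps_zero_entry[OF assms(1)] tensor_zero_entry)
qed

text \<open>Used when supports leave a single shape \<open>\<rho>\<close> of block sizes. The bound
  \<open>l \<le> N\<close> on the number of blocks imposes nothing extra, since the blocks are
  nonempty.\<close>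

lemma sum_partitions_single:
  fixes f :: "nat \<Rightarrow> nat list \<Rightarrow> 'b::comm_monoid_add" and N :: nat
  defines "R \<equiv> \<lambda>l. {rs. length rs = l \<and> 0 \<notin> set rs \<and> sum_list rs = N \<and> sorted rs}"
  assumes f: "\<And>l rs. rs \<in> R l \<Longrightarrow> rs \<noteq> \<rho> \<Longrightarrow> f l rs = 0"
  shows "(\<Sum>l=2..N. \<Sum>rs\<in>R l. f l rs) =
    (if 2 \<le> length \<rho> \<and> \<rho> \<in> R (length \<rho>) then f (length \<rho>) \<rho> else 0)"
proof -
  have fin: "finite (R l)" for l
  proof (rule finite_subset)
    show "R l \<subseteq> {rs. set rs \<subseteq> {..N} \<and> length rs = l}"
      by (auto simp: R_def member_le_sum_list)
    show "finite {rs. set rs \<subseteq> {..N} \<and> length rs = l}"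
      by (rule finite_lists_length_eq) simp
  qed
  have len: "length rs \<le> sum_list rs" if "0 \<notin> set rs" for rs :: "nat list"
    using that by (induction rs) auto
  have inner: "(\<Sum>rs\<in>R l. f l rs) = (if \<rho> \<in> R l then f l \<rho> else 0)" for l
  proof -
    have "(\<Sum>rs\<in>R l. f l rs) = (\<Sum>rs\<in>R l. if rs = \<rho> then f l \<rho> else 0)"
      using f by (intro sum.cong) auto
    also have "\<dots> = (if \<rho> \<in> R l then f l \<rho> else 0)"
      using fin by (rule sum.delta)
    finally show ?thesis .
  qed
  have "(\<Sum>l=2..N. \<Sum>rs\<in>R l. f l rs) =
      (\<Sum>l=2..N. if l = length \<rho> then (if \<rho> \<in> R (length \<rho>) then f (length \<rho>) \<rho> else 0) else 0)"
    unfolding inner by (intro sum.cong) (auto simp: R_def)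
  also have "\<dots> = (if length \<rho> \<in> {2..N} then (if \<rho> \<in> R (length \<rho>) then f (length \<rho>) \<rho> else 0) else 0)"
    by (rule sum.delta) simp
  also have "\<dots> = (if 2 \<le> length \<rho> \<and> \<rho> \<in> R (length \<rho>) then f (length \<rho>) \<rho> else 0)"
    using len[of \<rho>] by (auto simp: R_def)
  finally show ?thesis .
qed

lemma strict_mono_on_lessThan_iff:
  fixes f :: "nat \<Rightarrow> nat"
  shows "strict_mono_on {..<n} f \<longleftrightarrow> (\<forall>i. Suc i < n \<longrightarrow> f i < f (Suc i))"
proof
  assume f: "\<forall>i. Suc i < n \<longrightarrow> f i < f (Suc i)"
  have "f i < f j" if "i < j" "j < n" for i j
    using that
  proof (induction j)
    case (Suc j)
    have "f j < f (Suc j)"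
      using f Suc.prems by blast
    moreover have "i = j \<or> f i < f j"
      using Suc by (metis Suc_lessD less_SucE)
    ultimately show ?case
      by (metis less_trans)
  qed simp
  then show "strict_mono_on {..<n} f"
    by (intro strict_mono_onI) simp
qed (simp add: strict_mono_onD)

text \<open>Increase within a block of size one is an empty condition, while the comparisons between
  consecutive singletons say that the first \<open>n\<close> values increase. This makes the coset
  argument available for these sums.\<close>

lemma unshuffles_lt_ones_eq_unshuffles: "unshuffles_lt_ones n m = unshuffles [n, m]"
proof -
  let ?rs = "replicate n 1 @ [m]"
  have start: "block_start ?rs i = i" if "i \<le> n" for i
    using that by (simp add: block_start_def min_def sum_list_replicate)
  have last: "block_start ?rs (Suc n) = n + m"
    by (simp add: block_start_def sum_list_replicate)
  have "strict_mono_on {block_start ?rs i..<block_start ?rs (Suc i)} \<sigma>" if "i < n" for i and \<sigma> :: "nat \<Rightarrow> nat"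
    using that start[of i] start[of "Suc i"] by (intro strict_mono_onI) simp
  then have "(\<forall>i<length ?rs. strict_mono_on {block_start ?rs i..<block_start ?rs (Suc i)} \<sigma>) \<longleftrightarrow>
      strict_mono_on {n..<n + m} \<sigma>" for \<sigma> :: "nat \<Rightarrow> nat"
    using start[of n] last by (simp add: All_less_Suc)
  moreover have "sum_list ?rs = n + m"
    by (simp add: sum_list_replicate)
  ultimately have iff: "\<sigma> \<in> unshuffles ?rs \<longleftrightarrow>
      \<sigma> permutes {..<n + m} \<and> strict_mono_on {n..<n + m} \<sigma>" for \<sigma>
    unfolding unshuffles_def by (simp only: mem_Collect_eq)
  show ?thesis
    unfolding unshuffles_lt_ones_def
    by (rule set_eqI, simp only: mem_Collect_eq iff unshuffles_two_iff strict_mono_on_lessThan_iff) blast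
qed

text \<open>Comparing all neighbouring singletons makes the permutation increasing everywhere, and
  only the identity is.\<close>

lemma unshuffles_lt_replicate_one: "unshuffles_lt (replicate n 1) = {id}"
proof -
  have start: "block_start (replicate n 1) i = i" if "i \<le> n" for i
    using that by (simp add: block_start_def min_def sum_list_replicate)
  have "id \<in> unshuffles_lt (replicate n 1)"
    using start by (auto simp: unshuffles_lt_def unshuffles_def permutes_id intro: strict_mono_onI)
  moreover have "\<sigma> = id" if "\<sigma> \<in> unshuffles_lt (replicate n 1)" for \<sigma>
  proof -
    have perm: "\<sigma> permutes {..<n}"
      using unshufflesD[OF unshuffles_ltD[OF that]] by (simp add: sum_list_replicate)
    have "\<sigma> i < \<sigma> (Suc i)" if "Suc i < n" for i
    proof -
      have "Suc i < length (replicate n (1::nat)) \<and> replicate n (1::nat) ! i = replicate n 1 ! Suc i"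
        using that by simp
      then have "\<sigma> (block_start (replicate n 1) i) < \<sigma> (block_start (replicate n 1) (Suc i))"
        using \<open>\<sigma> \<in> _\<close> unfolding unshuffles_lt_def by blast
      then show ?thesis
        using that start by simp
    qed
    then have "strict_mono_on {0..<n} \<sigma>"
      unfolding lessThan_atLeast0[symmetric] strict_mono_on_lessThan_iff by blast
    then have "\<sigma> i = id i" if "i < n" for i
      using that strict_mono_on_image_unique[of 0 n \<sigma> id i] permutes_image[OF perm]
      by (simp add: strict_mono_on_id lessThan_atLeast0)
    moreover have "\<sigma> i = id i" if "\<not> i < n" for i
      using permutes_not_in[OF perm] that by simp
    ultimately show ?thesis
      by blast
  qed
  ultimately show ?thesis
    by blast
qed

text \<open>The value at \<open>n\<close> is the one element missing from the image of the first
  block, and that image determines the unshuffle.\<close>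

lemma bij_betw_unshuffles_last: "bij_betw (\<lambda>\<sigma>. \<sigma> n) (unshuffles [n, 1]) {..<Suc n}"
proof -
  have perm: "\<sigma> permutes {..<Suc n}" if "\<sigma> \<in> unshuffles [n, 1]" for \<sigma>
    using that by (simp add: unshuffles_two_iff)
  have image: "\<sigma> ` {..<n} = {..<Suc n} - {\<sigma> n}" if "\<sigma> \<in> unshuffles [n, 1]" for \<sigma>
  proof -
    have "{..<n} = {..<Suc n} - {n}"
      by auto
    then show ?thesis
      using permutes_image[OF perm[OF that]] image_set_diff[OF permutes_inj[OF perm[OF that]]]
      by (metis image_empty image_insert)
  qed
  have lt: "\<sigma> n < Suc n" if "\<sigma> \<in> unshuffles [n, 1]" for \<sigma>
    using permutes_in_image[OF perm[OF that], of n] by simp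
  have "inj_on (\<lambda>\<sigma>. \<sigma> n) (unshuffles [n, 1])"
    using image by (intro inj_onI unshuffles_two_unique[of _ n 1]) simp_all
  moreover have "i \<in> (\<lambda>\<sigma>. \<sigma> n) ` unshuffles [n, 1]" if i: "i < Suc n" for i
  proof -
    have "{..<Suc n} - {i} \<subseteq> {..<n + 1}" "card ({..<Suc n} - {i}) = n"
      using i by auto
    then obtain u where u: "u \<in> unshuffles [n, 1]" "u ` {..<n} = {..<Suc n} - {i}"
      using unshuffles_two_exists by blast
    then have "{..<Suc n} - {u n} = {..<Suc n} - {i}"
      using image by metis
    then have "u n = i"
      using i by blast
    then show ?thesis
      using u(1) by blast
  qed
  ultimately show ?thesis
    using lt by (auto simp: bij_betw_def)
qed

text \<open>The case \<open>m = 1\<close>: moving \<open>Y\<close> to position \<open>i\<close> with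
  the inputs in order is compared with keeping \<open>Y\<close> last and unshuffling the inputs by
  the \<open>\<sigma>\<close> with \<open>\<sigma> n = i\<close>. The two argument lists of
  \<open>X\<close> differ by \<open>\<sigma>\<close>, and its sign cancels the one in
  \<open>sgn_sum\<close>.\<close>

lemma sum_skew_positions:
  assumes s: "vector_space s" and X: "skew_on s (Suc n) {..<Suc n} X" and xs: "length xs = Suc n"
  shows "(\<Sum>i<Suc n. X (map (\<lambda>k. if k = i then Y [xs ! k] else g (xs ! k)) [0..<Suc n])) =
    sgn_sum s (unshuffles [n, 1]) (comp_tensor X (replicate n (1, unary g) @ [(1, Y)])) xs"
proof -
  interpret vector_space s by fact
  define L where "L i = map (\<lambda>k. if k = i then Y [xs ! k] else g (xs ! k)) [0..<Suc n]" for i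
  have len: "length (L i) = Suc n" for i
    by (simp add: L_def)
  have L: "L i ! k = (if k = i then Y [xs ! k] else g (xs ! k))" if "k < Suc n" for i k
    using that unfolding L_def by (simp only: nth_map_upt length_upt) simp
  have "s (of_int (sign \<sigma>))
      (comp_tensor X (replicate n (1, unary g) @ [(1, Y)]) (permute_list \<sigma> xs)) = X (L (\<sigma> n))"
    if "\<sigma> \<in> unshuffles [n, 1]" for \<sigma>
  proof -
    have \<sigma>: "\<sigma> permutes {..<Suc n}"
      using that by (simp add: unshuffles_two_iff)
    let ?ps = "permute_list \<sigma> xs"
    have ps: "length ?ps = Suc n" "?ps ! k = xs ! \<sigma> k" if "k < Suc n" for k
      using xs \<sigma> that by (simp_all add: permute_list_nth)
    \<comment> \<open>In \<open>L (\<sigma> n)\<close> the factor \<open>Y\<close> stands at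
      position \<open>\<sigma> n\<close>, which \<open>\<sigma>\<close> brings to the last
      place.\<close>
    have "map g (take n ?ps) @ [Y (drop n ?ps)] = permute_list \<sigma> (L (\<sigma> n))"
    proof (rule nth_equalityI)
      show "length (map g (take n ?ps) @ [Y (drop n ?ps)]) = length (permute_list \<sigma> (L (\<sigma> n)))"
        using xs len by simp
      fix k assume "k < length (map g (take n ?ps) @ [Y (drop n ?ps)])"
      then have k: "k < Suc n"
        using xs by simp
      have \<sigma>k: "\<sigma> k < Suc n"
        using permutes_in_image[OF \<sigma>, of k] k by simp
      have "drop n ?ps = [xs ! \<sigma> n]"
        using Cons_nth_drop_Suc[of n ?ps] ps[of n] by simp
      moreover have "\<sigma> k = \<sigma> n \<longleftrightarrow> k = n"
        using permutes_inj[OF \<sigma>] by (simp add: inj_eq)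
      moreover have "permute_list \<sigma> (L (\<sigma> n)) ! k = L (\<sigma> n) ! \<sigma> k"
        using \<sigma> len k by (intro permute_list_nth) simp_all
      ultimately show "(map g (take n ?ps) @ [Y (drop n ?ps)]) ! k = permute_list \<sigma> (L (\<sigma> n)) ! k"
        using k L[OF \<sigma>k] ps xs by (auto simp: nth_append less_Suc_eq)
    qed
    then have "comp_tensor X (replicate n (1, unary g) @ [(1, Y)]) ?ps =
        s (of_int (sign \<sigma>)) (X (L (\<sigma> n)))"
      using comp_tensor_ones[of ?ps n 1 X g Y] skew_onD[OF X \<sigma> len] xs by simp
    then show ?thesis
      by simp
  qed
  then have "sgn_sum s (unshuffles [n, 1]) (comp_tensor X (replicate n (1, unary g) @ [(1, Y)])) xs =
      (\<Sum>\<sigma>\<in>unshuffles [n, 1]. X (L (\<sigma> n)))"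
    by (simp add: sgn_sum_def)
  also have "\<dots> = (\<Sum>i<Suc n. X (L i))"
    by (rule sum.reindex_bij_betw[OF bij_betw_unshuffles_last])
  finally show ?thesis
    unfolding L_def by (rule sym)
qed

text \<open>The root \<open>X\<close> fixes the number of blocks as \<open>n + 1\<close>,
  \<open>Y\<close> fixes the size of its block as \<open>m\<close>, and \<open>B\<close> fixes all
  others as \<open>1\<close>. The order of the sizes then decides where the block of
  \<open>Y\<close> can be. The coefficient \<open>c\<close> stays arbitrary, since only its value at
  the surviving shape matters.\<close>

lemma nu_root_sum:
  fixes X :: "nat \<Rightarrow> 'v::ab_group_add list \<Rightarrow> 'v" and Y :: "nat \<Rightarrow> 'u::ab_group_add list \<Rightarrow> 'v"
  assumes s: "vector_space s"
    and X: "\<And>l. X l \<in> multilinear_maps s s l" "skew_on s (Suc n) {..<Suc n} (X (Suc n))"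
      "\<And>l. l \<noteq> Suc n \<or> n = 0 \<Longrightarrow> X l = (\<lambda>_. 0)"
    and Y: "\<And>r. r \<noteq> m \<or> m = 0 \<Longrightarrow> Y r = (\<lambda>_. 0)"
    and B: "B 1 = unary g" "\<And>r. r \<noteq> 1 \<Longrightarrow> B r = (\<lambda>_. 0)"
    and xs: "length xs = N"
  shows "(\<Sum>l=2..N. \<Sum>rs\<in>{rs. length rs = l \<and> 0 \<notin> set rs \<and> sum_list rs = N \<and> sorted rs}.
      s (c l rs) (\<Sum>\<sigma>\<in>unshuffles_lt rs. s (of_int (sign \<sigma>))
        (\<Sum>i<length rs. nu_term X (\<lambda>k. if k = i then Y else B) rs (permute_list \<sigma> xs)))) =
    (if N = n + m
     then s (c (Suc n) (replicate n 1 @ [m])) (sgn_sum s (unshuffles_lt_ones n m)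
       (comp_tensor (X (Suc n)) (replicate n (1, unary g) @ [(m, Y m)])) xs)
     else 0)"
    (is "?lhs = ?rhs")
proof (cases "n = 0 \<or> m = 0")
  case True
  interpret vector_space s by fact
  \<comment> \<open>In the degenerate degrees either the root \<open>X\<close> or the factor
    \<open>Y\<close> is zero in every arity, so both sides vanish.\<close>
  have "nu_term X (\<lambda>k. if k = i then Y else B) rs ys = 0" if "i < length rs" for i rs ys
    using True
  proof
    assume "n = 0"
    then show ?thesis
      using X(3) by (simp add: nu_term_def comp_tensor_def)
  next
    assume "m = 0"
    then show ?thesis
      using Y that by (intro nu_term_zero[where X = X and rs = rs and k = i, OF X(1)]) simp_all
  qed
  then have "?lhs = 0"
    by simp
  moreover have "comp_tensor (X (Suc n)) (replicate n (1, unary g) @ [(m, Y m)]) ys = 0" for ys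
    using True
  proof
    assume "n = 0"
    then show ?thesis
      using X(3) by (simp add: comp_tensor_def)
  next
    assume "m = 0"
    then have "(m, \<lambda>_. 0) \<in> set (replicate n (1, unary g) @ [(m, Y m)])"
      using Y by simp
    then show ?thesis
      unfolding comp_tensor_def by (intro multilinear_maps_zero_entry[OF X(1)] tensor_zero_entry)
  qed
  then have "?rhs = 0"
    by (simp add: sgn_sum_0[OF s])
  ultimately show ?thesis
    by simp
next
  case False
  interpret vector_space s by fact
  let ?\<rho> = "replicate n 1 @ [m]"
  have \<rho>: "?\<rho> ! k = (if k < n then 1 else m)" if "k < Suc n" for k
    using that by (simp add: nth_append)
  have zero: "nu_term X (\<lambda>k. if k = i then Y else B) rs ys = 0"
    if "i < length rs" "length rs \<noteq> Suc n \<or> rs ! i \<noteq> m \<or> (\<exists>k<length rs. k \<noteq> i \<and> rs ! k \<noteq> 1)" for i rs ys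
    using that(2)
  proof (elim disjE exE conjE)
    assume "length rs \<noteq> Suc n"
    then show ?thesis
      using X(3) by (simp add: nu_term_def comp_tensor_def)
  next
    assume "rs ! i \<noteq> m"
    then show ?thesis
      using Y that(1) by (intro nu_term_zero[where X = X and rs = rs and k = i, OF X(1)]) simp_all
  next
    fix k assume "k < length rs" "k \<noteq> i" "rs ! k \<noteq> 1"
    then show ?thesis
      using B(2) by (intro nu_term_zero[where X = X and rs = rs and k = k, OF X(1)]) simp_all
  qed
  have shape: "rs = ?\<rho>"
    if "i < length rs" "length rs = Suc n" "rs ! i = m" "\<And>k. k < length rs \<Longrightarrow> k \<noteq> i \<Longrightarrow> rs ! k = 1"
      "sorted rs" for i rs
  proof -
    \<comment> \<open>A block of size \<open>m > 1\<close> before the last place would precede a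
      block of size \<open>1\<close>, against sortedness.\<close>
    have "m = 1 \<or> i = n"
    proof (rule ccontr)
      assume *: "\<not> (m = 1 \<or> i = n)"
      then have "rs ! i \<le> rs ! n"
        using that by (intro sorted_nth_mono) simp_all
      moreover have "rs ! n = 1"
        using that(2,4) * by simp
      ultimately show False
        using * False that(3) by simp
    qed
    then show ?thesis
      using that \<rho> by (intro nth_equalityI) (auto simp: less_Suc_eq)
  qed
  have sums: "?lhs = (if 2 \<le> length ?\<rho> \<and> ?\<rho> \<in> {rs. length rs = length ?\<rho> \<and> 0 \<notin> set rs \<and> sum_list rs = N \<and> sorted rs}
      then s (c (length ?\<rho>) ?\<rho>) (\<Sum>\<sigma>\<in>unshuffles_lt ?\<rho>. s (of_int (sign \<sigma>))
        (\<Sum>i<length ?\<rho>. nu_term X (\<lambda>k. if k = i then Y else B) ?\<rho> (permute_list \<sigma> xs))) else 0)"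
  proof (rule sum_partitions_single)
    fix l rs
    assume rs: "rs \<in> {rs. length rs = l \<and> 0 \<notin> set rs \<and> sum_list rs = N \<and> sorted rs}" "rs \<noteq> ?\<rho>"
    have "nu_term X (\<lambda>k. if k = i then Y else B) rs ys = 0" if "i < length rs" for i ys
      using zero[OF that] shape[OF that] rs by blast
    then show "s (c l rs) (\<Sum>\<sigma>\<in>unshuffles_lt rs. s (of_int (sign \<sigma>))
        (\<Sum>i<length rs. nu_term X (\<lambda>k. if k = i then Y else B) rs (permute_list \<sigma> xs))) = 0"
      by simp
  qed
  have mem: "2 \<le> length ?\<rho> \<and> ?\<rho> \<in> {rs. length rs = length ?\<rho> \<and> 0 \<notin> set rs \<and> sum_list rs = N \<and> sorted rs}
      \<longleftrightarrow> N = n + m"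
    using False by (auto simp: sorted_append sum_list_replicate)
  have val: "(\<Sum>\<sigma>\<in>unshuffles_lt ?\<rho>. s (of_int (sign \<sigma>))
        (\<Sum>i<length ?\<rho>. nu_term X (\<lambda>k. if k = i then Y else B) ?\<rho> (permute_list \<sigma> xs))) =
      sgn_sum s (unshuffles_lt_ones n m)
        (comp_tensor (X (Suc n)) (replicate n (1, unary g) @ [(m, Y m)])) xs" if N: "N = n + m"
  proof (cases "m = 1")
    case True
    then have \<rho>1: "?\<rho> = replicate (Suc n) 1"
      by (metis replicate_append_same replicate_Suc)
    \<comment> \<open>Here all \<open>n + 1\<close> positions of \<open>Y\<close> survive, and the
      identity is the only unshuffle.\<close>
    have "nu_term X (\<lambda>k. if k = i then Y else B) (replicate (Suc n) 1) xs =
        X (Suc n) (map (\<lambda>k. if k = i then Y 1 [xs ! k] else g (xs ! k)) [0..<Suc n])" for i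
    proof -
      define G where "G k = (if k = i then Y else B) 1" for k
      have "map (\<lambda>k. (replicate (Suc n) (1::nat) ! k, (if k = i then Y else B) (replicate (Suc n) 1 ! k)))
          [0..<Suc n] = map (\<lambda>k. (1::nat, G k)) [0..<Suc n]"
        unfolding G_def by (intro map_cong) (simp_all del: upt_Suc replicate_Suc)
      moreover have "tensor (map (\<lambda>k. (1, G k)) [0..<Suc n]) xs =
          map (\<lambda>(k, x). G k [x]) (zip [0..<Suc n] xs)"
        using xs N True by (intro tensor_map_ones) simp
      ultimately have "nu_term X (\<lambda>k. if k = i then Y else B) (replicate (Suc n) 1) xs =
          X (Suc n) (map (\<lambda>(k, x). G k [x]) (zip [0..<Suc n] xs))"
        unfolding nu_term_def comp_tensor_def length_replicate
        by (simp only:)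
      also have "map (\<lambda>(k, x). G k [x]) (zip [0..<Suc n] xs) =
          map (\<lambda>k. if k = i then Y 1 [xs ! k] else g (xs ! k)) [0..<Suc n]"
        using xs N True B(1)
        by (intro nth_equalityI) (auto simp: G_def unary_def simp del: upt_Suc)
      finally show ?thesis .
    qed
    then have "(\<Sum>i<Suc n. nu_term X (\<lambda>k. if k = i then Y else B) (replicate (Suc n) 1) xs) =
        sgn_sum s (unshuffles [n, 1]) (comp_tensor (X (Suc n)) (replicate n (1, unary g) @ [(1, Y 1)])) xs"
      using sum_skew_positions[OF s X(2), of xs "Y 1" g] xs N True by simp
    then show ?thesis
      unfolding \<rho>1
      unfolding unshuffles_lt_replicate_one unshuffles_lt_ones_eq_unshuffles True
      by (simp del: replicate_Suc sum.lessThan_Suc)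
  next
    case False
    have "(\<Sum>i<length ?\<rho>. nu_term X (\<lambda>k. if k = i then Y else B) ?\<rho> ys) =
        comp_tensor (X (Suc n)) (replicate n (1, unary g) @ [(m, Y m)]) ys" for ys
    proof -
      \<comment> \<open>A position before the last has arity \<open>1\<close>, which differs from
        \<open>m\<close>, so \<open>Y\<close> vanishes there.\<close>
      have "nu_term X (\<lambda>k. if k = i then Y else B) ?\<rho> ys = 0" if "i < n" for i
        using that False \<rho> by (intro zero) auto
      then have "(\<Sum>i<length ?\<rho>. nu_term X (\<lambda>k. if k = i then Y else B) ?\<rho> ys) =
          nu_term X (\<lambda>k. if k = n then Y else B) ?\<rho> ys"
        by simp
      moreover have "map (\<lambda>k. (?\<rho> ! k, (if k = n then Y else B) (?\<rho> ! k))) [0..<length ?\<rho>] =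
          replicate n (1, unary g) @ [(m, Y m)]"
        using B(1) by (intro nth_equalityI) (auto simp: nth_append less_Suc_eq simp del: upt_Suc)
      ultimately show ?thesis
        unfolding nu_term_def by simp
    qed
    then show ?thesis
      unfolding unshuffles_lt_ones_eq[OF False] sgn_sum_def by simp
  qed
  show ?thesis
    unfolding sums mem using val by simp
qed

text \<open>The supports force the block sizes \<open>[n, m]\<close>, and this list is sorted only
  for \<open>n \<le> m\<close>. This is the origin of the vanishing of one bracket term when the
  degrees differ.\<close>

lemma nu_binary_sum:
  fixes Y Z :: "nat \<Rightarrow> 'u::ab_group_add list \<Rightarrow> 'v::ab_group_add"
  assumes s: "vector_space s"
    and b: "\<And>x. b x 0 = 0" "\<And>x. b 0 x = 0"
    and Y: "\<And>r. r \<noteq> n \<or> n = 0 \<Longrightarrow> Y r = (\<lambda>_. 0)" and Z: "\<And>r. r \<noteq> m \<or> m = 0 \<Longrightarrow> Z r = (\<lambda>_. 0)"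
  shows "(\<Sum>l=2..N. \<Sum>rs\<in>{rs. length rs = l \<and> 0 \<notin> set rs \<and> sum_list rs = N \<and> sorted rs}.
      s (c l rs) (\<Sum>\<sigma>\<in>unshuffles_lt rs. s (of_int (sign \<sigma>))
        (if length rs = 2
         then comp_tensor (binary b) [(rs ! 0, Y (rs ! 0)), (rs ! 1, Z (rs ! 1))] (permute_list \<sigma> xs)
         else 0))) =
    (if N = n + m \<and> n \<le> m
     then s (c 2 [n, m]) (sgn_sum s (unshuffles_lt [n, m])
       (comp_tensor (binary b) [(n, Y n), (m, Z m)]) xs)
     else 0)"
    (is "?lhs = ?rhs")
proof -
  interpret vector_space s by fact
  have zero: "comp_tensor (binary b) [(r, Y r), (r', Z r')] ys = 0"
    if "r \<noteq> n \<or> r' \<noteq> m \<or> n = 0 \<or> m = 0" for r r' ys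
  proof -
    have "Y r = (\<lambda>_. 0) \<or> Z r' = (\<lambda>_. 0)"
      using that Y Z by blast
    then show ?thesis
      using b by (auto simp: comp_tensor_def binary_def)
  qed
  have "?lhs = (if 2 \<le> length [n, m] \<and> [n, m] \<in> {rs. length rs = length [n, m] \<and> 0 \<notin> set rs \<and> sum_list rs = N \<and> sorted rs}
      then s (c (length [n, m]) [n, m]) (\<Sum>\<sigma>\<in>unshuffles_lt [n, m]. s (of_int (sign \<sigma>))
        (if length [n, m] = 2
         then comp_tensor (binary b) [([n, m] ! 0, Y ([n, m] ! 0)), ([n, m] ! 1, Z ([n, m] ! 1))] (permute_list \<sigma> xs)
         else 0)) else 0)"
  proof (rule sum_partitions_single)
    fix l rs
    assume rs: "rs \<in> {rs. length rs = l \<and> 0 \<notin> set rs \<and> sum_list rs = N \<and> sorted rs}" "rs \<noteq> [n, m]"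
    have "(if length rs = 2
        then comp_tensor (binary b) [(rs ! 0, Y (rs ! 0)), (rs ! 1, Z (rs ! 1))] ys else 0) = 0" for ys
    proof (cases "length rs = 2")
      case True
      then have "rs = [rs ! 0, rs ! 1]"
        by (auto simp: length_Suc_conv numeral_2_eq_2)
      then have "rs ! 0 \<noteq> n \<or> rs ! 1 \<noteq> m"
        using rs(2) by metis
      then show ?thesis
        using zero by auto
    qed simp
    then show "s (c l rs) (\<Sum>\<sigma>\<in>unshuffles_lt rs. s (of_int (sign \<sigma>))
        (if length rs = 2
         then comp_tensor (binary b) [(rs ! 0, Y (rs ! 0)), (rs ! 1, Z (rs ! 1))] (permute_list \<sigma> xs)
         else 0)) = 0"
      by (simp only: scale_zero_right sum.neutral_const)
  qed
  also have "\<dots> = (if n \<noteq> 0 \<and> m \<noteq> 0 \<and> N = n + m \<and> n \<le> m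
     then s (c 2 [n, m]) (sgn_sum s (unshuffles_lt [n, m])
       (comp_tensor (binary b) [(n, Y n), (m, Z m)]) xs)
     else 0)"
    by (auto simp: sgn_sum_def numeral_2_eq_2)
  \<comment> \<open>If \<open>n\<close> or \<open>m\<close> is \<open>0\<close> then a factor of the
    composite is zero, so the nonzero conditions may be dropped.\<close>
  also have "\<dots> = ?rhs"
    using zero[of n m] by (auto simp: sgn_sum_0[OF s])
  finally show ?thesis .
qed

text \<open>With \<open>l = n + 1\<close> both parts of the exponent equal n(n+1)/2, so their sum is
  even. The last block size \<open>m\<close> does not enter because the sum stops at
  \<open>l - 1\<close>.\<close>

lemma sign_exponent_ones:
  "(-1 :: 'k::ring_1) ^ (Suc n * (Suc n - 1) div 2 +
     (\<Sum>i=1..Suc n - 1. (replicate n 1 @ [m]) ! (i - 1) * (Suc n - i))) = 1"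
proof -
  have "(\<Sum>i=1..Suc n - 1. (replicate n 1 @ [m]) ! (i - 1) * (Suc n - i)) = (\<Sum>i=1..n. Suc n - i)"
    by (rule sum.cong) (auto simp: nth_append)
  also have "\<dots> = (\<Sum>i=1..n. i)"
    using sum.atLeastAtMost_rev[of "\<lambda>i. i" 1 n] by simp
  also have "\<dots> = Suc n * (Suc n - 1) div 2"
    using Sum_Icc_nat[of 1 n] by (simp add: mult.commute)
  finally show ?thesis
    by (metis mult_2 power_minus1_even)
qed

section \<open>The operation \<open>l\<^sub>2\<close>\<close>

lemma insertion_two: "insertion b [F, G] [x, y] v = (if v = x then F else if v = y then G else b)"
  by (simp add: insertion_def)

lemma insertion_pair:
  "insertion b [F, G] [0, Suc i] 0 = F"
  "insertion b [F, G] [0, Suc i] (Suc k) = (if k = i then G else b)"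
  "insertion b [F, G] [Suc i, 0] 0 = G"
  "insertion b [F, G] [Suc i, 0] (Suc k) = (if k = i then F else b)"
  "insertion b [F, G] [Suc i, Suc j] 0 = b"
  "insertion b [F, G] [Suc i, Suc j] (Suc k) = (if k = i then F else if k = j then G else b)"
  by (simp_all add: insertion_two)

lemma nu_exponent_two: "nu_exponent [n, m] = n"
proof -
  have "{1..2::nat} = {1, 2}"
    by auto
  then show ?thesis
    by (simp add: nu_exponent_def numeral_2_eq_2)
qed

lemma l_op_two:
  "on_mu (l_op sU sV b [(n, F), (m, G)]) N xs = (if length xs \<noteq> N then 0 else sU ((-1) ^ n)
     (lin_ext sU (\<lambda>\<Gamma>. \<Sum>vs\<in>vertex_tuples 2 (vertices_bracket \<Gamma>).
        gamma_bracket (\<lambda>v. on_mu (insertion b [F, G] vs v)) \<Gamma> xs) (boundary_bracket N)))"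
  "on_nu (l_op sU sV b [(n, F), (m, G)]) N ys = (if length ys \<noteq> N then 0 else sV ((-1) ^ n)
     (lin_ext sV (\<lambda>\<Gamma>. \<Sum>vs\<in>vertex_tuples 2 (vertices_bracket \<Gamma>).
        gamma_bracket (\<lambda>v. on_nu (insertion b [F, G] vs v)) \<Gamma> ys) (boundary_bracket N)))"
  "on_f (l_op sU sV b [(n, F), (m, G)]) N xs = (if length xs \<noteq> N then 0 else sV ((-1) ^ n)
     (lin_ext sV (\<lambda>\<Gamma>. \<Sum>vs\<in>vertex_tuples 2 (vertices_f \<Gamma>).
        gamma_f (insertion b [F, G] vs) \<Gamma> xs) (boundary_f N)))"
proof -
  have [simp]: "Suc (Suc 0) = 2" by simp
  show "on_mu (l_op sU sV b [(n, F), (m, G)]) N xs = (if length xs \<noteq> N then 0 else sU ((-1) ^ n)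
     (lin_ext sU (\<lambda>\<Gamma>. \<Sum>vs\<in>vertex_tuples 2 (vertices_bracket \<Gamma>).
        gamma_bracket (\<lambda>v. on_mu (insertion b [F, G] vs v)) \<Gamma> xs) (boundary_bracket N)))"
    by (simp add: l_op_def Let_def lin_ext_def nu_exponent_two)
  show "on_nu (l_op sU sV b [(n, F), (m, G)]) N ys = (if length ys \<noteq> N then 0 else sV ((-1) ^ n)
     (lin_ext sV (\<lambda>\<Gamma>. \<Sum>vs\<in>vertex_tuples 2 (vertices_bracket \<Gamma>).
        gamma_bracket (\<lambda>v. on_nu (insertion b [F, G] vs v)) \<Gamma> ys) (boundary_bracket N)))"
    by (simp add: l_op_def Let_def lin_ext_def nu_exponent_two)
  show "on_f (l_op sU sV b [(n, F), (m, G)]) N xs = (if length xs \<noteq> N then 0 else sV ((-1) ^ n)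
     (lin_ext sV (\<lambda>\<Gamma>. \<Sum>vs\<in>vertex_tuples 2 (vertices_f \<Gamma>).
        gamma_f (insertion b [F, G] vs) \<Gamma> xs) (boundary_f N)))"
    by (simp add: l_op_def Let_def lin_ext_def nu_exponent_two)
qed

lemma skew_mapsI:
  assumes "multilinear_on s s' n F" "skew_on s' n {..<n} F"
    and "\<And>xs. G xs = (if length xs = n then F xs else 0)"
  shows "G \<in> skew_maps s s' n"
  unfolding skew_maps_iff
  using multilinear_on_cong[OF assms(1), of G] skew_on_cong[OF assms(2), of G] assms(3) by simp

lemma zero_in_skew_maps:
  "vector_space s \<Longrightarrow> vector_space s' \<Longrightarrow> (\<lambda>_. 0) \<in> skew_maps s s' n"
  by (simp add: skew_maps_iff multilinear_on_0 skew_on_0)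

lemma sgn_sum_circ1:
  assumes s: "vector_space s" "vector_space s'"
    and X: "X \<in> skew_maps s s' (Suc q)" and Y: "Y \<in> skew_maps s s p" and N: "N = p + q"
  shows "multilinear_on s s' N (sgn_sum s' (unshuffles [p, q]) (circ1 p X Y))"
    and "skew_on s' N {..<N} (sgn_sum s' (unshuffles [p, q]) (circ1 p X Y))"
proof -
  show "multilinear_on s s' N (sgn_sum s' (unshuffles [p, q]) (circ1 p X Y))"
    unfolding N using X Y
    by (intro multilinear_on_sgn_sum s multilinear_on_circ1)
      (simp_all add: skew_maps_iff unshuffles_two_iff)
  show "skew_on s' N {..<N} (sgn_sum s' (unshuffles [p, q]) (circ1 p X Y))"
    unfolding N using X Y
    by (intro skew_on_sgn_sum_unshuffles s skew_on_circ1[OF s]) (simp_all add: skew_maps_iff)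
qed

text \<open>Stated for abstract families \<open>T\<close>, \<open>W\<close>, \<open>D\<close> and
  \<open>L\<close> so that the black and the white colour are both instances.\<close>

lemma l2_bracket:
  fixes T W :: "nat \<Rightarrow> 'a::ab_group_add list \<Rightarrow> 'a"
  assumes s: "vector_space s"
    and T: "\<And>k. T k \<in> skew_maps s s k" "\<And>k. k \<noteq> n + 1 \<or> n + 1 < 2 \<Longrightarrow> T k = (\<lambda>_. 0)"
    and W: "\<And>k. W k \<in> skew_maps s s k" "\<And>k. k \<noteq> m + 1 \<or> m + 1 < 2 \<Longrightarrow> W k = (\<lambda>_. 0)"
    and D: "D [0, 1] 0 = T" "D [0, 1] 1 = W" "D [1, 0] 0 = W" "D [1, 0] 1 = T"
    and L: "\<And>N xs. L N xs = (if length xs \<noteq> N then 0 else s ((-1) ^ n)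
      (lin_ext s (\<lambda>\<Gamma>. \<Sum>vs\<in>vertex_tuples 2 (vertices_bracket \<Gamma>). gamma_bracket (D vs) \<Gamma> xs)
        (boundary_bracket N)))"
  shows "length xs = n + m + 1 \<Longrightarrow> L (n + m + 1) xs = s ((-1) ^ (m * n))
      (sgn_sum s (unshuffles [m + 1, n]) (circ1 (m + 1) (T (n + 1)) (W (m + 1))) xs
       + s ((-1) ^ (m + n)) (sgn_sum s (unshuffles [n + 1, m]) (circ1 (n + 1) (W (m + 1)) (T (n + 1))) xs))"
    and "N \<noteq> n + m + 1 \<or> N < 2 \<Longrightarrow> L N = (\<lambda>_. 0)"
    and "L N \<in> skew_maps s s N"
proof -
  interpret vector_space s by fact
  have TW: "T k \<in> multilinear_maps s s k" "W k \<in> multilinear_maps s s k" for k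
    using T(1) W(1) by (simp_all add: skew_maps_def)
  define M where "M xs = s ((-1) ^ (m * n))
      (sgn_sum s (unshuffles [m + 1, n]) (circ1 (m + 1) (T (n + 1)) (W (m + 1))) xs
       + s ((-1) ^ (m + n)) (sgn_sum s (unshuffles [n + 1, m]) (circ1 (n + 1) (W (m + 1)) (T (n + 1))) xs))" for xs
  \<comment> \<open>The prefactor (-1)^n meets the coefficients of the differential: n + (m+1)n has
    the parity of mn, and n + (n+1)m equals mn + m + n.\<close>
  have e: "(-1) ^ n * (-1) ^ ((m + 1) * n) = ((-1) ^ (m * n) :: 'b)"
    "(-1) ^ n * (-1) ^ ((n + 1) * m) = ((-1) ^ (m * n) * (-1) ^ (m + n) :: 'b)"
    by (auto simp: minus_one_power_iff)
  have sum: "lin_ext s (\<lambda>\<Gamma>. \<Sum>vs\<in>vertex_tuples 2 (vertices_bracket \<Gamma>). gamma_bracket (D vs) \<Gamma> xs)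
      (boundary_bracket N) =
    (if N = n + m + 1
     then s ((-1) ^ ((m + 1) * n)) (sgn_sum s (unshuffles [m + 1, n]) (circ1 (m + 1) (T (n + 1)) (W (m + 1))) xs)
        + s ((-1) ^ ((n + 1) * m)) (sgn_sum s (unshuffles [n + 1, m]) (circ1 (n + 1) (W (m + 1)) (T (n + 1))) xs)
     else 0)" for N xs
    by (rule bracket_graph_sum[OF s TW(1) T(2) TW(2) W(2) D])
  have LM: "L N xs = (if length xs = N \<and> N = n + m + 1 then M xs else 0)" for N xs
  proof (cases "length xs = N \<and> N = n + m + 1")
    case True
    then show ?thesis
      unfolding L sum M_def
      by (simp only: scale_right_distrib scale_scale e if_True refl not_True_eq_False if_False conj_absorb simp_thms)
  next
    case False
    then show ?thesis
      unfolding L sum by auto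
  qed
  show "length xs = n + m + 1 \<Longrightarrow> L (n + m + 1) xs = s ((-1) ^ (m * n))
      (sgn_sum s (unshuffles [m + 1, n]) (circ1 (m + 1) (T (n + 1)) (W (m + 1))) xs
       + s ((-1) ^ (m + n)) (sgn_sum s (unshuffles [n + 1, m]) (circ1 (n + 1) (W (m + 1)) (T (n + 1))) xs))"
    unfolding LM M_def by simp
  \<comment> \<open>The only critical arity is \<open>N = 1\<close>, with \<open>n = m = 0\<close>:
    arity \<open>1\<close> is no generator, so the value there must vanish, and it does because both
    cochains are zero.\<close>
  show "L N = (\<lambda>_. 0)" if "N \<noteq> n + m + 1 \<or> N < 2"
  proof (cases "N = n + m + 1")
    case True
    then have "n = 0" "m = 0"
      using that by auto
    then have "T 1 = (\<lambda>_. 0)" "W 1 = (\<lambda>_. 0)"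
      using T(2) W(2) by auto
    then have "M xs = 0" for xs
      unfolding M_def using \<open>n = 0\<close> \<open>m = 0\<close> by (simp add: sgn_sum_0[OF s] circ1_zero_left)
    then show ?thesis
      by (simp add: LM fun_eq_iff)
  qed (simp add: LM fun_eq_iff)
  show "L N \<in> skew_maps s s N"
  proof (cases "N = n + m + 1")
    case True
    have "multilinear_on s s N M"
      unfolding M_def
      by (intro multilinear_on_scale multilinear_on_add sgn_sum_circ1(1)[OF s s])
        (use T(1)[of "Suc n"] W(1)[of "Suc m"] True in simp_all)
    moreover have "skew_on s N {..<N} M"
      unfolding M_def
      by (intro skew_on_scale skew_on_add s sgn_sum_circ1(2)[OF s s])
        (use T(1)[of "Suc n"] W(1)[of "Suc m"] True in simp_all)
    ultimately show ?thesis
      by (rule skew_mapsI) (simp add: LM True)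
  next
    case False
    then have "L N = (\<lambda>_. 0)"
      by (simp add: LM fun_eq_iff)
    then show ?thesis
      by (simp add: zero_in_skew_maps s)
  qed
qed

text \<open>The first two sums have a cochain at the root. Otherwise the root is decorated by
  \<open>b\<close>, which leaves only a binary root; its two factors are then both occupied by
  cochains, in one of two orders.\<close>

lemma nu_vertex_sum:
  assumes b: "\<And>l. l \<noteq> 2 \<Longrightarrow> on_nu b l = (\<lambda>_. 0)" "on_nu b 2 = binary \<mu>"
  shows "(\<Sum>vs\<in>vertex_tuples 2 (vertices_f (Nu_Fs rs \<sigma>)). gamma_f (insertion b [F, G] vs) (Nu_Fs rs \<sigma>) xs) =
    (\<Sum>i<length rs. nu_term (on_nu F) (\<lambda>k. if k = i then on_f G else on_f b) rs (permute_list \<sigma> xs)) +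
    (\<Sum>i<length rs. nu_term (on_nu G) (\<lambda>k. if k = i then on_f F else on_f b) rs (permute_list \<sigma> xs)) +
    ((if length rs = 2
      then comp_tensor (binary \<mu>) [(rs ! 0, on_f F (rs ! 0)), (rs ! 1, on_f G (rs ! 1))] (permute_list \<sigma> xs)
      else 0) +
     (if length rs = 2
      then comp_tensor (binary \<mu>) [(rs ! 0, on_f G (rs ! 0)), (rs ! 1, on_f F (rs ! 1))] (permute_list \<sigma> xs)
      else 0))"
proof -
  let ?ys = "permute_list \<sigma> xs"
  have 1: "gamma_f (insertion b [F, G] [0, Suc i]) (Nu_Fs rs \<sigma>) xs =
      nu_term (on_nu F) (\<lambda>k. if k = i then on_f G else on_f b) rs ?ys" for i
    by (simp add: nu_term_def insertion_pair if_distrib[of on_f])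
  have 2: "gamma_f (insertion b [F, G] [Suc i, 0]) (Nu_Fs rs \<sigma>) xs =
      nu_term (on_nu G) (\<lambda>k. if k = i then on_f F else on_f b) rs ?ys" for i
    by (simp add: nu_term_def insertion_pair if_distrib[of on_f])
  have 3: "gamma_f (insertion b [F, G] [Suc i, Suc j]) (Nu_Fs rs \<sigma>) xs =
      nu_term (on_nu b) (\<lambda>k. if k = i then on_f F else if k = j then on_f G else on_f b) rs ?ys" for i j
    by (simp add: nu_term_def insertion_pair if_distrib[of on_f] cong: if_cong)
  have "(\<Sum>i<length rs. \<Sum>j\<in>{..<length rs} - {i}.
      nu_term (on_nu b) (\<lambda>k. if k = i then on_f F else if k = j then on_f G else on_f b) rs ?ys) =
     (if length rs = 2
      then comp_tensor (binary \<mu>) [(rs ! 0, on_f F (rs ! 0)), (rs ! 1, on_f G (rs ! 1))] ?ys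
      else 0) +
     (if length rs = 2
      then comp_tensor (binary \<mu>) [(rs ! 0, on_f G (rs ! 0)), (rs ! 1, on_f F (rs ! 1))] ?ys
      else 0)"
  proof (cases "length rs = 2")
    case True
    have "{..<2::nat} = {0, 1}" "{0, 1} - {0} = {1::nat}" "{0, 1} - {1} = {0::nat}"
      by auto
    moreover have "[0..<2] = [0, 1]"
      by (simp add: upt_rec)
    ultimately show ?thesis
      using True b(2) by (simp add: nu_term_def)
  next
    case False
    then show ?thesis
      using b(1) by (simp add: nu_term_def comp_tensor_def)
  qed
  then show ?thesis
    unfolding vertices_f.simps sum_vertex_tuples_two_atMost 1 2 3 by (rule arg_cong)
qed

text \<open>The signs are still those of the differential: \<open>1\<close> for blocks 1, ..., 1, m,
  the power with exponent \<open>1 + n\<close> or \<open>1 + m\<close> for two blocks, and the outer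
  minus of the graphs with an \<open>f\<close> at the root. The prefactor of \<open>l_2\<close> is
  merged in by \<open>collect_signs\<close>.\<close>

lemma f_graph_sum:
  assumes s: "vector_space sU" "vector_space sV"
    and b: "\<And>l. l \<noteq> 2 \<Longrightarrow> on_nu b l = (\<lambda>_. 0)" "on_nu b 2 = binary \<mu>"
      "on_f b 1 = unary g" "\<And>r. r \<noteq> 1 \<Longrightarrow> on_f b r = (\<lambda>_. 0)"
    and \<mu>: "\<And>x. \<mu> x 0 = 0" "\<And>x. \<mu> 0 x = 0"
    and F: "\<And>k. on_nu F k \<in> skew_maps sV sV k" "\<And>k. on_f F k \<in> skew_maps sU sV k"
      "\<And>k. k \<noteq> Suc n \<or> n = 0 \<Longrightarrow> on_mu F k = (\<lambda>_. 0)"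
      "\<And>k. k \<noteq> Suc n \<or> n = 0 \<Longrightarrow> on_nu F k = (\<lambda>_. 0)"
      "\<And>k. k \<noteq> n \<or> n = 0 \<Longrightarrow> on_f F k = (\<lambda>_. 0)"
    and G: "\<And>k. on_nu G k \<in> skew_maps sV sV k" "\<And>k. on_f G k \<in> skew_maps sU sV k"
      "\<And>k. k \<noteq> Suc m \<or> m = 0 \<Longrightarrow> on_mu G k = (\<lambda>_. 0)"
      "\<And>k. k \<noteq> Suc m \<or> m = 0 \<Longrightarrow> on_nu G k = (\<lambda>_. 0)"
      "\<And>k. k \<noteq> m \<or> m = 0 \<Longrightarrow> on_f G k = (\<lambda>_. 0)"
    and xs: "length xs = N"
  shows "lin_ext sV (\<lambda>\<Gamma>. \<Sum>vs\<in>vertex_tuples 2 (vertices_f \<Gamma>). gamma_f (insertion b [F, G] vs) \<Gamma> xs)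
      (boundary_f N) =
    (if N = n + m then
      sgn_sum sV (unshuffles_lt_ones n m)
        (comp_tensor (on_nu F (Suc n)) (replicate n (1, unary g) @ [(m, on_f G m)])) xs
      + sgn_sum sV (unshuffles_lt_ones m n)
        (comp_tensor (on_nu G (Suc m)) (replicate m (1, unary g) @ [(n, on_f F n)])) xs
      + ((if n \<le> m then sV ((-1) ^ (1 + n)) (sgn_sum sV (unshuffles_lt [n, m])
            (comp_tensor (binary \<mu>) [(n, on_f F n), (m, on_f G m)]) xs) else 0)
        + (if m \<le> n then sV ((-1) ^ (1 + m)) (sgn_sum sV (unshuffles_lt [m, n])
            (comp_tensor (binary \<mu>) [(m, on_f G m), (n, on_f F n)]) xs) else 0))
      - (sV ((-1) ^ ((m + 1) * (n - 1)))
          (sgn_sum sV (unshuffles [m + 1, n - 1]) (circ1 (m + 1) (on_f F n) (on_mu G (m + 1))) xs)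
        + sV ((-1) ^ ((n + 1) * (m - 1)))
          (sgn_sum sV (unshuffles [n + 1, m - 1]) (circ1 (n + 1) (on_f G m) (on_mu F (n + 1))) xs))
     else 0)"
proof -
  interpret V: vector_space sV by fact
  let ?R = "\<lambda>l. {rs. length rs = l \<and> 0 \<notin> set rs \<and> sum_list rs = N \<and> sorted rs}"
  define c :: "nat \<Rightarrow> nat list \<Rightarrow> 'a" where
    "c l rs = (-1) ^ (l * (l - 1) div 2 + (\<Sum>i=1..l-1. rs ! (i - 1) * (l - i)))" for l rs
  have c: "c (Suc k) (replicate k 1 @ [r]) = 1" for k r
    unfolding c_def by (rule sign_exponent_ones)
  have c2: "c 2 [k, r] = (-1) ^ (1 + k)" for k r
    by (simp add: c_def)
  have mult: "on_nu F k \<in> multilinear_maps sV sV k" "on_nu G k \<in> multilinear_maps sV sV k"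
    "on_f F k \<in> multilinear_maps sU sV k" "on_f G k \<in> multilinear_maps sU sV k" for k
    using F(1,2) G(1,2) by (simp_all add: skew_maps_def)
  have skew: "skew_on sV (Suc k) {..<Suc k} (on_nu F (Suc k))"
    "skew_on sV (Suc k) {..<Suc k} (on_nu G (Suc k))" for k
    using F(1)[of "Suc k"] G(1)[of "Suc k"] by (simp_all add: skew_maps_iff)
  have vs: "(\<Sum>vs\<in>vertex_tuples 2 (vertices_f (Nu_Fs rs \<sigma>)). gamma_f (insertion b [F, G] vs) (Nu_Fs rs \<sigma>) xs) =
      (\<Sum>i<length rs. nu_term (on_nu F) (\<lambda>k. if k = i then on_f G else on_f b) rs (permute_list \<sigma> xs)) +
      (\<Sum>i<length rs. nu_term (on_nu G) (\<lambda>k. if k = i then on_f F else on_f b) rs (permute_list \<sigma> xs)) +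
      ((if length rs = 2
      then comp_tensor (binary \<mu>) [(rs ! 0, on_f F (rs ! 0)), (rs ! 1, on_f G (rs ! 1))] (permute_list \<sigma> xs)
      else 0) + (if length rs = 2
      then comp_tensor (binary \<mu>) [(rs ! 0, on_f G (rs ! 0)), (rs ! 1, on_f F (rs ! 1))] (permute_list \<sigma> xs)
      else 0))" for rs \<sigma>
    by (rule nu_vertex_sum[OF b(1,2)])
  have root_F: "(\<Sum>l=2..N. \<Sum>rs\<in>?R l. sV (c l rs) (\<Sum>\<sigma>\<in>unshuffles_lt rs. sV (of_int (sign \<sigma>)) (
        \<Sum>i<length rs. nu_term (on_nu F) (\<lambda>k. if k = i then on_f G else on_f b) rs (permute_list \<sigma> xs)))) =
      (if N = n + m then sV (c (Suc n) (replicate n 1 @ [m])) (sgn_sum sV (unshuffles_lt_ones n m)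
        (comp_tensor (on_nu F (Suc n)) (replicate n (1, unary g) @ [(m, on_f G m)])) xs) else 0)"
    by (rule nu_root_sum; (fact s(2) mult(1) skew(1) b(3) xs | erule F(4) G(5) b(4)))
  have root_G: "(\<Sum>l=2..N. \<Sum>rs\<in>?R l. sV (c l rs) (\<Sum>\<sigma>\<in>unshuffles_lt rs. sV (of_int (sign \<sigma>)) (
        \<Sum>i<length rs. nu_term (on_nu G) (\<lambda>k. if k = i then on_f F else on_f b) rs (permute_list \<sigma> xs)))) =
      (if N = m + n then sV (c (Suc m) (replicate m 1 @ [n])) (sgn_sum sV (unshuffles_lt_ones m n)
        (comp_tensor (on_nu G (Suc m)) (replicate m (1, unary g) @ [(n, on_f F n)])) xs) else 0)"
    by (rule nu_root_sum; (fact s(2) mult(2) skew(2) b(3) xs | erule G(4) F(5) b(4)))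
  have bin_FG: "(\<Sum>l=2..N. \<Sum>rs\<in>?R l. sV (c l rs) (\<Sum>\<sigma>\<in>unshuffles_lt rs. sV (of_int (sign \<sigma>)) (if length rs = 2
      then comp_tensor (binary \<mu>) [(rs ! 0, on_f F (rs ! 0)), (rs ! 1, on_f G (rs ! 1))] (permute_list \<sigma> xs)
      else 0))) =
      (if N = n + m \<and> n \<le> m then sV (c 2 [n, m]) (sgn_sum sV (unshuffles_lt [n, m])
        (comp_tensor (binary \<mu>) [(n, on_f F n), (m, on_f G m)]) xs) else 0)"
    by (rule nu_binary_sum; (fact s(2) \<mu> | erule F(5) G(5)))
  have bin_GF: "(\<Sum>l=2..N. \<Sum>rs\<in>?R l. sV (c l rs) (\<Sum>\<sigma>\<in>unshuffles_lt rs. sV (of_int (sign \<sigma>)) (if length rs = 2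
      then comp_tensor (binary \<mu>) [(rs ! 0, on_f G (rs ! 0)), (rs ! 1, on_f F (rs ! 1))] (permute_list \<sigma> xs)
      else 0))) =
      (if N = m + n \<and> m \<le> n then sV (c 2 [m, n]) (sgn_sum sV (unshuffles_lt [m, n])
        (comp_tensor (binary \<mu>) [(m, on_f G m), (n, on_f F n)]) xs) else 0)"
    by (rule nu_binary_sum; (fact s(2) \<mu> | erule G(5) F(5)))
  have nu: "(\<Sum>l=2..N. \<Sum>rs\<in>?R l. sV (c l rs) (\<Sum>\<sigma>\<in>unshuffles_lt rs. sV (of_int (sign \<sigma>))
        (\<Sum>vs\<in>vertex_tuples 2 (vertices_f (Nu_Fs rs \<sigma>)). gamma_f (insertion b [F, G] vs) (Nu_Fs rs \<sigma>) xs))) =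
      (if N = n + m then
        sgn_sum sV (unshuffles_lt_ones n m)
          (comp_tensor (on_nu F (Suc n)) (replicate n (1, unary g) @ [(m, on_f G m)])) xs
        + sgn_sum sV (unshuffles_lt_ones m n)
          (comp_tensor (on_nu G (Suc m)) (replicate m (1, unary g) @ [(n, on_f F n)])) xs
        + ((if n \<le> m then sV ((-1) ^ (1 + n)) (sgn_sum sV (unshuffles_lt [n, m])
              (comp_tensor (binary \<mu>) [(n, on_f F n), (m, on_f G m)]) xs) else 0)
          + (if m \<le> n then sV ((-1) ^ (1 + m)) (sgn_sum sV (unshuffles_lt [m, n])
              (comp_tensor (binary \<mu>) [(m, on_f G m), (n, on_f F n)]) xs) else 0))
       else 0)"
    by (simp only: vs V.scale_right_distrib sum.distrib root_F root_G bin_FG bin_GF c c2)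
      (simp add: add.commute[of m n])
  have mu: "(\<Sum>\<sigma>\<in>unshuffles [j, i - 1]. sV (of_int (sign \<sigma>))
        (\<Sum>vs\<in>vertex_tuples 2 (vertices_f (F_Mu i j \<sigma>)). gamma_f (insertion b [F, G] vs) (F_Mu i j \<sigma>) xs)) =
      sgn_sum sV (unshuffles [j, i - 1]) (circ1 j (on_f F i) (on_mu G j)) xs +
      sgn_sum sV (unshuffles [j, i - 1]) (circ1 j (on_f G i) (on_mu F j)) xs" for i j
    unfolding vertices_f.simps vertex_tuples_two_01
    by (simp add: insertion_two sgn_sum_def V.scale_right_distrib sum.distrib)
  have "(\<Sum>(i, j)\<in>{(i, j). i + j = N + 1 \<and> 1 \<le> i \<and> 2 \<le> j}. sV ((-1) ^ (j * (i - 1)))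
        (sgn_sum sV (unshuffles [j, i - 1]) (circ1 j (on_f F i) (on_mu G j)) xs)) =
      (if N + 1 = n + Suc m then sV ((-1) ^ (Suc m * (n - 1)))
        (sgn_sum sV (unshuffles [Suc m, n - 1]) (circ1 (Suc m) (on_f F n) (on_mu G (Suc m))) xs) else 0)"
    using F(5) G(3) by (intro sum_circ1[OF s(2) mult(3)]) auto
  moreover have "(\<Sum>(i, j)\<in>{(i, j). i + j = N + 1 \<and> 1 \<le> i \<and> 2 \<le> j}. sV ((-1) ^ (j * (i - 1)))
        (sgn_sum sV (unshuffles [j, i - 1]) (circ1 j (on_f G i) (on_mu F j)) xs)) =
      (if N + 1 = m + Suc n then sV ((-1) ^ (Suc n * (m - 1)))
        (sgn_sum sV (unshuffles [Suc n, m - 1]) (circ1 (Suc n) (on_f G m) (on_mu F (Suc n))) xs) else 0)"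
    using G(5) F(3) by (intro sum_circ1[OF s(2) mult(4)]) auto
  ultimately have f: "(\<Sum>(i, j)\<in>{(i, j). i + j = N + 1 \<and> 1 \<le> i \<and> 2 \<le> j}. sV ((-1) ^ (j * (i - 1)))
        (sgn_sum sV (unshuffles [j, i - 1]) (circ1 j (on_f F i) (on_mu G j)) xs +
         sgn_sum sV (unshuffles [j, i - 1]) (circ1 j (on_f G i) (on_mu F j)) xs)) =
      (if N = n + m then
        sV ((-1) ^ ((m + 1) * (n - 1)))
          (sgn_sum sV (unshuffles [m + 1, n - 1]) (circ1 (m + 1) (on_f F n) (on_mu G (m + 1))) xs)
        + sV ((-1) ^ ((n + 1) * (m - 1)))
          (sgn_sum sV (unshuffles [n + 1, m - 1]) (circ1 (n + 1) (on_f G m) (on_mu F (n + 1))) xs)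
       else 0)"
    by (simp add: V.scale_right_distrib sum.distrib case_prod_unfold)
  show ?thesis
    unfolding V.lin_ext_boundary_f mu f nu[unfolded c_def] by simp
qed

section \<open>Exchange of two blocks of equal size\<close>

text \<open>A partial exchange, of the first \<open>k\<close> entries of two adjacent blocks of
  length \<open>n\<close>. The parameter \<open>k\<close> exists for the induction that computes the
  sign; the full exchange is \<open>k = n\<close>.\<close>

definition block_swap :: "nat \<Rightarrow> nat \<Rightarrow> nat \<Rightarrow> nat" where
  "block_swap n k i = (if i < k then i + n else if n \<le> i \<and> i < n + k then i - n else i)"

text \<open>Each increase of \<open>k\<close> contributes one further transposition, of
  \<open>k\<close> with \<open>n + k\<close>.\<close>

lemma block_swap:
  assumes "k \<le> n"
  shows "block_swap n k permutes {..<n + n} \<and> sign (block_swap n k) = (-1) ^ k"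
  using assms
proof (induction k)
  case 0
  have "block_swap n 0 = id"
    by (auto simp: block_swap_def)
  then show ?case
    by (metis permutes_id sign_id power_0)
next
  case (Suc k)
  have "block_swap n (Suc k) i = (block_swap n k \<circ> transpose k (n + k)) i" for i
    using Suc.prems by (auto simp: block_swap_def transpose_def)
  then have eq: "block_swap n (Suc k) = block_swap n k \<circ> transpose k (n + k)"
    by blast
  have t: "transpose k (n + k) permutes {..<n + n}"
    using Suc.prems by (intro permutes_swap_id) simp_all
  have IH: "block_swap n k permutes {..<n + n}" "sign (block_swap n k) = (-1) ^ k"
    using Suc by simp_all
  have "sign (transpose k (n + k)) = - 1"
    using Suc.prems by (simp add: sign_swap_id)
  then have "sign (block_swap n (Suc k)) = (-1) ^ Suc k"
    unfolding eq by (subst sign_compose_permutes[OF IH(1) t]) (simp_all add: IH(2))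
  then show ?case
    unfolding eq using permutes_compose[OF t IH(1)] by blast
qed

lemma permute_list_block_swap:
  assumes "length xs = n + n"
  shows "take n (permute_list (block_swap n n) xs) = drop n xs"
    and "drop n (permute_list (block_swap n n) xs) = take n xs"
  using assms by (auto intro!: nth_equalityI simp: permute_list_def block_swap_def add.commute)

lemma unshuffles_lt_two_neq: "n \<noteq> m \<Longrightarrow> unshuffles_lt [n, m] = unshuffles [n, m]"
  by (auto simp: unshuffles_lt_def less_Suc_eq)

lemma unshuffles_lt_two_eq:
  "\<sigma> \<in> unshuffles_lt [n, n] \<longleftrightarrow> \<sigma> \<in> unshuffles [n, n] \<and> \<sigma> 0 < \<sigma> n"
  by (auto simp: unshuffles_lt_def block_start_def less_Suc_eq)

lemma unshuffles_block_swap: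
  assumes "\<sigma> \<in> unshuffles [n, n]"
  shows "\<sigma> \<circ> block_swap n n \<in> unshuffles [n, n]"
proof -
  have \<sigma>: "\<sigma> permutes {..<n + n}" "strict_mono_on {..<n} \<sigma>" "strict_mono_on {n..<n + n} \<sigma>"
    using assms by (simp_all add: unshuffles_two_iff)
  have "\<sigma> \<circ> block_swap n n permutes {..<n + n}"
    using block_swap[of n n] \<sigma>(1) by (intro permutes_compose) auto
  moreover have "strict_mono_on {..<n} (\<sigma> \<circ> block_swap n n)"
    using \<sigma>(3) by (auto intro!: strict_mono_onI simp: block_swap_def strict_mono_onD)
  moreover have "strict_mono_on {n..<n + n} (\<sigma> \<circ> block_swap n n)"
    using \<sigma>(2) by (auto intro!: strict_mono_onI simp: block_swap_def strict_mono_onD)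
  ultimately show ?thesis
    by (simp add: unshuffles_two_iff)
qed

text \<open>Composition with the block exchange matches the ordered unshuffles with the remaining
  ones, since it interchanges the values at \<open>0\<close> and \<open>n\<close>. For odd
  \<open>n\<close> the exchange has sign -1, which cancels the minus in the relation between
  \<open>Q\<close> and \<open>P\<close>: the \<open>Q\<close> terms are exactly the missing
  \<open>P\<close> terms.\<close>

lemma sgn_sum_block_swap:
  assumes s: "vector_space s" and n: "odd n" and xs: "length xs = n + n"
    and PQ: "\<And>ys. length ys = n + n \<Longrightarrow> Q ys = - P (permute_list (block_swap n n) ys)"
  shows "sgn_sum s (unshuffles_lt [n, n]) P xs + sgn_sum s (unshuffles_lt [n, n]) Q xs =
    sgn_sum s (unshuffles [n, n]) P xs"
proof -
  interpret vector_space s by fact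
  let ?\<tau> = "block_swap n n" and ?lt = "unshuffles_lt [n, n]" and ?U = "unshuffles [n, n]"
  have \<tau>: "?\<tau> permutes {..<n + n}" "sign ?\<tau> = - 1"
    using block_swap[of n n] n by simp_all
  have n0: "0 < n"
    using n by (rule odd_pos)
  have \<tau>\<tau>: "\<sigma> \<circ> ?\<tau> \<circ> ?\<tau> = \<sigma>" for \<sigma> :: "nat \<Rightarrow> nat"
    by (rule ext) (auto simp: block_swap_def)
  have \<tau>0: "(\<sigma> \<circ> ?\<tau>) 0 = \<sigma> n" "(\<sigma> \<circ> ?\<tau>) n = \<sigma> 0" for \<sigma> :: "nat \<Rightarrow> nat"
    using n0 by (simp_all add: block_swap_def)
  have inj: "\<sigma> 0 \<noteq> \<sigma> n" if "\<sigma> \<in> ?U" for \<sigma>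
  proof
    assume "\<sigma> 0 = \<sigma> n"
    moreover have "inj \<sigma>"
      using that unshuffles_two_iff permutes_inj by blast
    ultimately show False
      using n0 by (simp add: inj_eq)
  qed
  define f where "f \<sigma> = s (of_int (sign \<sigma>)) (P (permute_list \<sigma> xs))" for \<sigma>
  have "bij_betw (\<lambda>\<sigma>. \<sigma> \<circ> ?\<tau>) ?lt (?U - ?lt)"
  proof (rule bij_betw_byWitness[where f' = "\<lambda>\<sigma>. \<sigma> \<circ> ?\<tau>"])
    show "\<forall>\<sigma>\<in>?lt. \<sigma> \<circ> ?\<tau> \<circ> ?\<tau> = \<sigma>" "\<forall>\<sigma>\<in>?U - ?lt. \<sigma> \<circ> ?\<tau> \<circ> ?\<tau> = \<sigma>"
      using \<tau>\<tau> by blast+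
    show "(\<lambda>\<sigma>. \<sigma> \<circ> ?\<tau>) ` ?lt \<subseteq> ?U - ?lt"
    proof (rule image_subsetI)
      fix \<sigma> assume \<sigma>: "\<sigma> \<in> ?lt"
      then have "\<not> (\<sigma> \<circ> ?\<tau>) 0 < (\<sigma> \<circ> ?\<tau>) n"
        unfolding \<tau>0 unshuffles_lt_two_eq by simp
      then show "\<sigma> \<circ> ?\<tau> \<in> ?U - ?lt"
        using \<sigma> unshuffles_block_swap unfolding unshuffles_lt_two_eq Diff_iff by blast
    qed
    show "(\<lambda>\<sigma>. \<sigma> \<circ> ?\<tau>) ` (?U - ?lt) \<subseteq> ?lt"
    proof (rule image_subsetI)
      fix \<sigma> assume \<sigma>: "\<sigma> \<in> ?U - ?lt"
      then have "(\<sigma> \<circ> ?\<tau>) 0 < (\<sigma> \<circ> ?\<tau>) n"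
        unfolding \<tau>0 Diff_iff unshuffles_lt_two_eq using inj[of \<sigma>] by auto
      then show "\<sigma> \<circ> ?\<tau> \<in> ?lt"
        using \<sigma> unshuffles_block_swap unfolding unshuffles_lt_two_eq Diff_iff by blast
    qed
  qed
  then have "(\<Sum>\<sigma>\<in>?U - ?lt. f \<sigma>) = (\<Sum>\<sigma>\<in>?lt. f (\<sigma> \<circ> ?\<tau>))"
    by (rule sum.reindex_bij_betw[symmetric])
  also have "\<dots> = sgn_sum s ?lt Q xs"
    unfolding sgn_sum_def
  proof (rule sum.cong)
    fix \<sigma> assume "\<sigma> \<in> ?lt"
    then have \<sigma>: "\<sigma> permutes {..<n + n}"
      by (simp add: unshuffles_lt_two_eq unshuffles_two_iff)
    have "permute_list (\<sigma> \<circ> ?\<tau>) xs = permute_list ?\<tau> (permute_list \<sigma> xs)"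
      using \<tau>(1) xs by (intro permute_list_compose) simp
    moreover have "sign (\<sigma> \<circ> ?\<tau>) = - sign \<sigma>"
      by (subst sign_compose_permutes[OF \<sigma> \<tau>(1)]) (simp_all add: \<tau>(2))
    moreover have "Q (permute_list \<sigma> xs) = - P (permute_list ?\<tau> (permute_list \<sigma> xs))"
      using xs by (intro PQ) simp
    ultimately show "f (\<sigma> \<circ> ?\<tau>) = s (of_int (sign \<sigma>)) (Q (permute_list \<sigma> xs))"
      unfolding f_def by (simp only: of_int_minus scale_minus_left scale_minus_right)
  qed simp
  finally have "(\<Sum>\<sigma>\<in>?U - ?lt. f \<sigma>) = sgn_sum s ?lt Q xs" .
  moreover have "?lt \<subseteq> ?U"
    using unshuffles_ltD by blast
  ultimately show ?thesis
    using sum.subset_diff[of ?lt ?U f] by (simp add: sgn_sum_def f_def add.commute)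
qed

section \<open>Arities of cochains, and properties and signs of the summands\<close>

text \<open>Degree \<open>p - 1\<close> singles out mu_(p+1), nu_(p+1) and f_p. For
  \<open>p = 0\<close> none of these is a generator, so the cochain vanishes altogether; the
  disjunct \<open>p = 0\<close> records this.\<close>

lemma cochainsD:
  assumes "\<theta> \<in> cochains sU sV p"
  shows "on_mu \<theta> k \<in> skew_maps sU sU k" "on_nu \<theta> k \<in> skew_maps sV sV k"
    "on_f \<theta> k \<in> skew_maps sU sV k"
    and "k \<noteq> Suc p \<or> p = 0 \<Longrightarrow> on_mu \<theta> k = (\<lambda>_. 0)"
    and "k \<noteq> Suc p \<or> p = 0 \<Longrightarrow> on_nu \<theta> k = (\<lambda>_. 0)"
    and "k \<noteq> p \<or> p = 0 \<Longrightarrow> on_f \<theta> k = (\<lambda>_. 0)"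
proof -
  show "on_mu \<theta> k \<in> skew_maps sU sU k" "on_nu \<theta> k \<in> skew_maps sV sV k"
    "on_f \<theta> k \<in> skew_maps sU sV k"
    using assms by (simp_all add: cochains_def)
  have \<theta>: "\<theta> \<in> graded_maps sU sV p"
    using assms by (simp add: cochains_def)
  have deg: "\<not> (is_generator (Mu k) \<and> generator_degree (Mu k) = int p - 1)"
    "\<not> (is_generator (Nu k) \<and> generator_degree (Nu k) = int p - 1)" if "k \<noteq> Suc p \<or> p = 0"
    using that by auto
  have deg_f: "\<not> (is_generator (Fn k) \<and> generator_degree (Fn k) = int p - 1)" if "k \<noteq> p \<or> p = 0"
    using that by auto
  show "on_mu \<theta> k = (\<lambda>_. 0)" if "k \<noteq> Suc p \<or> p = 0"
    using \<theta> deg(1)[OF that] unfolding graded_maps_def by blast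
  show "on_nu \<theta> k = (\<lambda>_. 0)" if "k \<noteq> Suc p \<or> p = 0"
    using \<theta> deg(2)[OF that] unfolding graded_maps_def by blast
  show "on_f \<theta> k = (\<lambda>_. 0)" if "k \<noteq> p \<or> p = 0"
    using \<theta> deg_f[OF that] unfolding graded_maps_def by blast
qed

lemma linear_diff:
  "Vector_Spaces.linear s s' f \<Longrightarrow> Vector_Spaces.linear s s' g \<Longrightarrow>
    Vector_Spaces.linear s s' (\<lambda>x. f x - g x)"
  unfolding module_hom_iff_linear[symmetric]
  by (rule module_pair.module_hom_sub) (auto intro: module_pair.intro dest: module_hom.axioms)

lemma multilinear_on_diff:
  assumes "multilinear_on s s' n F" "multilinear_on s s' n G"
  shows "multilinear_on s s' n (\<lambda>xs. F xs - G xs)"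
  using assms linear_diff unfolding multilinear_on_def by blast

lemma skew_on_diff:
  assumes "vector_space s" "skew_on s n A F" "skew_on s n A G"
  shows "skew_on s n A (\<lambda>xs. F xs - G xs)"
proof -
  interpret vector_space s by fact
  show ?thesis
    using assms(2,3) by (simp add: skew_on_def scale_right_diff_distrib)
qed

text \<open>For \<open>n > 0\<close> this is \<open>sgn_sum_circ1\<close> with
  \<open>q = n - 1\<close>. For \<open>n = 0\<close> truncated subtraction makes the block sizes add
  up to \<open>m + 1\<close> instead of \<open>m\<close>, but then the composite is zero.\<close>

lemma sgn_sum_circ1_pred:
  assumes s: "vector_space s" "vector_space s'"
    and X: "X \<in> skew_maps s s' n" "n = 0 \<Longrightarrow> X = (\<lambda>_. 0)" and Y: "Y \<in> skew_maps s s (m + 1)"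
    and N: "N = n + m"
  shows "multilinear_on s s' N (sgn_sum s' (unshuffles [m + 1, n - 1]) (circ1 (m + 1) X Y))"
    and "skew_on s' N {..<N} (sgn_sum s' (unshuffles [m + 1, n - 1]) (circ1 (m + 1) X Y))"
proof -
  have "multilinear_on s s' N (sgn_sum s' (unshuffles [m + 1, n - 1]) (circ1 (m + 1) X Y)) \<and>
    skew_on s' N {..<N} (sgn_sum s' (unshuffles [m + 1, n - 1]) (circ1 (m + 1) X Y))"
  proof (cases n)
    case 0
    then have "sgn_sum s' (unshuffles [m + 1, n - 1]) (circ1 (m + 1) X Y) = (\<lambda>_. 0)"
      using X(2) by (intro ext sgn_sum_0[OF s(2)]) (simp add: circ1_zero_left)
    then show ?thesis
      by (simp only: multilinear_on_0[OF s] skew_on_0[OF s(2)])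
  next
    case (Suc q)
    then have "X \<in> skew_maps s s' (Suc (n - 1))" "N = m + 1 + (n - 1)"
      using X(1) N by simp_all
    then show ?thesis
      using sgn_sum_circ1[OF s _ Y] by blast
  qed
  then show "multilinear_on s s' N (sgn_sum s' (unshuffles [m + 1, n - 1]) (circ1 (m + 1) X Y))"
    "skew_on s' N {..<N} (sgn_sum s' (unshuffles [m + 1, n - 1]) (circ1 (m + 1) X Y))"
    by blast+
qed

lemma sgn_sum_ones:
  assumes s: "vector_space s" "vector_space s'" and g: "Vector_Spaces.linear s s' g"
    and X: "X \<in> skew_maps s' s' (n + 1)" and Y: "Y \<in> skew_maps s s' m" and N: "N = n + m"
  shows "multilinear_on s s' N
      (sgn_sum s' (unshuffles_lt_ones n m) (comp_tensor X (replicate n (1, unary g) @ [(m, Y)])))"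
    and "skew_on s' N {..<N}
      (sgn_sum s' (unshuffles_lt_ones n m) (comp_tensor X (replicate n (1, unary g) @ [(m, Y)])))"
proof -
  have X': "multilinear_on s' s' (Suc n) X" "skew_on s' (Suc n) {..<Suc n} X"
    and Y': "multilinear_on s s' m Y" "skew_on s' m {..<m} Y"
    using X Y by (simp_all add: skew_maps_iff)
  show "multilinear_on s s' N
      (sgn_sum s' (unshuffles_lt_ones n m) (comp_tensor X (replicate n (1, unary g) @ [(m, Y)])))"
    unfolding N unshuffles_lt_ones_eq_unshuffles
    by (intro multilinear_on_sgn_sum s multilinear_on_comp_tensor_ones[OF X'(1) Y'(1) g])
      (simp add: unshuffles_two_iff)
  show "skew_on s' N {..<N}
      (sgn_sum s' (unshuffles_lt_ones n m) (comp_tensor X (replicate n (1, unary g) @ [(m, Y)])))"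
    unfolding N unshuffles_lt_ones_eq_unshuffles
    by (intro skew_on_sgn_sum_unshuffles s skew_on_comp_tensor_ones[OF s(2,2) X' Y'(2)])
qed

text \<open>Each summand is multilinear by itself, so the sum may run over ordered unshuffles. The
  skewness in the next lemma comes from the coset argument and therefore speaks of all
  unshuffles.\<close>

lemma multilinear_on_sgn_sum_binary:
  assumes s: "vector_space s" "vector_space s'"
    and b: "\<And>x. Vector_Spaces.linear s' s' (b x)" "\<And>y. Vector_Spaces.linear s' s' (\<lambda>x. b x y)"
    and Y: "Y \<in> skew_maps s s' n" and Z: "Z \<in> skew_maps s s' m" and N: "N = n + m"
  shows "multilinear_on s s' N (sgn_sum s' (unshuffles_lt [n, m]) (comp_tensor (binary b) [(n, Y), (m, Z)]))"
  unfolding N using Y Z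
  by (intro multilinear_on_sgn_sum s multilinear_on_comp_tensor_binary[OF b])
    (auto simp: skew_maps_iff unshuffles_two_iff dest!: unshuffles_ltD)

lemma skew_on_sgn_sum_binary:
  assumes s': "vector_space s'"
    and b: "\<And>x. Vector_Spaces.linear s' s' (b x)" "\<And>y. Vector_Spaces.linear s' s' (\<lambda>x. b x y)"
    and Y: "Y \<in> skew_maps s s' n" and Z: "Z \<in> skew_maps s s' m"
  shows "skew_on s' (n + m) {..<n + m}
    (sgn_sum s' (unshuffles [n, m]) (comp_tensor (binary b) [(n, Y), (m, Z)]))"
  using Y Z
  by (intro skew_on_sgn_sum_unshuffles s' skew_on_comp_tensor_binary[OF s' s' b])
    (simp_all add: skew_maps_iff)

lemma lie_algebra_antisym:
  assumes "lie_algebra s b"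
  shows "b y x = - b x y"
proof -
  interpret lie_algebra s b by fact
  have "b (x + y) z = b x z + b y z" "b z (x + y) = b z x + b z y" for z
    using linear_left[of z] linear_right[of z] module_hom.add[of s s "\<lambda>x. b x z" x y]
      module_hom.add[of s s "b z" x y] by (simp_all add: module_hom_iff_linear)
  then have "b x x + b x y + (b y x + b y y) = b (x + y) (x + y)"
    by simp
  then have "b x y + b y x = 0"
    by (simp add: bracket_self)
  then show ?thesis
    by (simp add: eq_neg_iff_add_eq_0 add.commute)
qed

text \<open>For positive \<open>n\<close> and \<open>m\<close>, both n + (m+1)(n-1) and n +
  (n+1)(m-1) have the parity of m(n-1) + 1, and this extra minus cancels the one of the
  differential. Truncated subtraction can break these parities if \<open>n\<close> or
  \<open>m\<close> is \<open>0\<close>, which is why \<open>c\<close> and \<open>c'\<close> are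
  assumed to vanish there.\<close>

lemma (in vector_space) collect_signs:
  assumes "n = 0 \<or> m = 0 \<Longrightarrow> c = 0 \<and> c' = 0"
  shows "scale ((-1) ^ n) (a + a' +
      ((if n \<le> m then scale ((-1) ^ (1 + n)) p else 0) + (if m \<le> n then scale ((-1) ^ (1 + m)) q else 0)) -
      (scale ((-1) ^ ((m + 1) * (n - 1))) c + scale ((-1) ^ ((n + 1) * (m - 1))) c')) =
    scale ((-1) ^ (m * (n - 1))) (c + c') + scale ((-1) ^ n) (a + a') -
    ((if m < n then 0 else p) + scale ((-1) ^ (n + m)) (if n < m then 0 else q))"
proof -
  have p: "scale ((-1) ^ n) (if n \<le> m then scale ((-1) ^ (1 + n)) p else 0) = - (if m < n then 0 else p)"
    by (simp add: minus_one_power_iff)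
  have q: "scale ((-1) ^ n) (if m \<le> n then scale ((-1) ^ (1 + m)) q else 0) =
      - scale ((-1) ^ (n + m)) (if n < m then 0 else q)"
    by (simp add: minus_one_power_iff)
  have c: "scale ((-1) ^ n) (scale ((-1) ^ ((m + 1) * (n - 1))) c) = - scale ((-1) ^ (m * (n - 1))) c"
    "scale ((-1) ^ n) (scale ((-1) ^ ((n + 1) * (m - 1))) c') = - scale ((-1) ^ (m * (n - 1))) c'"
    using assms by (cases n; cases m; auto simp: minus_one_power_iff)+
  show ?thesis
    by (simp only: scale_right_distrib scale_right_diff_distrib p q c) simp
qed

theorem theorem8p2:
  fixes sU :: "'k::field_char_0 \<Rightarrow> 'u::ab_group_add \<Rightarrow> 'u"
    and sV :: "'k \<Rightarrow> 'v::ab_group_add \<Rightarrow> 'v"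
    and \<mu>U :: "'u \<Rightarrow> 'u \<Rightarrow> 'u" and \<mu>V :: "'v \<Rightarrow> 'v \<Rightarrow> 'v" and g :: "'u \<Rightarrow> 'v"
    and n m :: nat and \<theta> \<omega> L :: "('u, 'v) gen_map"
  assumes "lie_algebra sU \<mu>U" and "lie_algebra sV \<mu>V" and "lie_morphism sU \<mu>U sV \<mu>V g"
    and "\<theta> \<in> cochains sU sV n" and "\<omega> \<in> cochains sU sV m"
    and "\<theta>U = on_mu \<theta> (n + 1)" and "\<theta>V = on_nu \<theta> (n + 1)" and "\<theta>g = on_f \<theta> n"
    and "\<omega>U = on_mu \<omega> (m + 1)" and "\<omega>V = on_nu \<omega> (m + 1)" and "\<omega>g = on_f \<omega> m"
    and "L = l_op sU sV (beta \<mu>U \<mu>V g) [(n, \<theta>), (m, \<omega>)]"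
  shows
    "L \<in> graded_maps sU sV (n + m) \<and>
     on_mu L (n + m + 1) \<in> skew_maps sU sU (n + m + 1) \<and>
     on_nu L (n + m + 1) \<in> skew_maps sV sV (n + m + 1) \<and>
     (n \<noteq> m \<or> odd n \<longrightarrow> L \<in> cochains sU sV (n + m)) \<and>
     (\<forall>xs. length xs = n + m + 1 \<longrightarrow>
       on_mu L (n + m + 1) xs =
         sU ((-1) ^ (m * n))
           (sgn_sum sU (unshuffles [m + 1, n]) (circ1 (m + 1) \<theta>U \<omega>U) xs
            + sU ((-1) ^ (m + n))
                (sgn_sum sU (unshuffles [n + 1, m]) (circ1 (n + 1) \<omega>U \<theta>U) xs))) \<and>
     (\<forall>xs. length xs = n + m + 1 \<longrightarrow>
       on_nu L (n + m + 1) xs =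
         sV ((-1) ^ (m * n))
           (sgn_sum sV (unshuffles [m + 1, n]) (circ1 (m + 1) \<theta>V \<omega>V) xs
            + sV ((-1) ^ (m + n))
                (sgn_sum sV (unshuffles [n + 1, m]) (circ1 (n + 1) \<omega>V \<theta>V) xs))) \<and>
     (\<forall>xs. length xs = n + m \<longrightarrow>
       on_f L (n + m) xs =
         sV ((-1) ^ (m * (n - 1)))
           (sgn_sum sV (unshuffles [m + 1, n - 1]) (circ1 (m + 1) \<theta>g \<omega>U) xs
            + sgn_sum sV (unshuffles [n + 1, m - 1]) (circ1 (n + 1) \<omega>g \<theta>U) xs)
         + sV ((-1) ^ n)
             (sgn_sum sV (unshuffles_lt_ones n m)
                (comp_tensor \<theta>V (replicate n (1, unary g) @ [(m, \<omega>g)])) xs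
              + sgn_sum sV (unshuffles_lt_ones m n)
                  (comp_tensor \<omega>V (replicate m (1, unary g) @ [(n, \<theta>g)])) xs)
         - ((if m < n then 0
             else sgn_sum sV (unshuffles_lt [n, m])
                    (comp_tensor (binary \<mu>V) [(n, \<theta>g), (m, \<omega>g)]) xs)
            + sV ((-1) ^ (n + m))
                (if n < m then 0
                 else sgn_sum sV (unshuffles_lt [m, n])
                        (comp_tensor (binary \<mu>V) [(m, \<omega>g), (n, \<theta>g)]) xs)))"
proof -
  have sU: "vector_space sU" and sV: "vector_space sV"
    using assms(1,2) by (simp_all add: lie_algebra_def)
  interpret V: vector_space sV by (fact sV)
  have g: "Vector_Spaces.linear sU sV g"
    using assms(3) by (simp add: lie_morphism_def)
  note \<mu>V = lie_algebra.linear_right[OF assms(2)] lie_algebra.linear_left[OF assms(2)]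
  have \<mu>V0: "\<mu>V x 0 = 0" "\<mu>V 0 x = 0" for x
    using linear_at_zero[OF \<mu>V(1)] linear_at_zero[OF \<mu>V(2)] by blast+
  note \<theta> = cochainsD[OF assms(4)] and \<omega> = cochainsD[OF assms(5)]
  have "\<theta>U \<in> skew_maps sU sU (n + 1)" "\<theta>V \<in> skew_maps sV sV (n + 1)" and \<theta>g: "\<theta>g \<in> skew_maps sU sV n"
    and "\<omega>U \<in> skew_maps sU sU (m + 1)" "\<omega>V \<in> skew_maps sV sV (m + 1)" and \<omega>g: "\<omega>g \<in> skew_maps sU sV m"
    unfolding assms(6-11) by (rule \<theta> \<omega>)+
  note skew = this
  have \<theta>g0: "\<theta>g = (\<lambda>_. 0)" if "n = 0"
    unfolding assms(8) using \<theta>(6) that by blast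
  have \<omega>g0: "\<omega>g = (\<lambda>_. 0)" if "m = 0"
    unfolding assms(11) using \<omega>(6) that by blast
  let ?b = "beta \<mu>U \<mu>V g"
  have b: "on_nu ?b 2 = binary \<mu>V" "on_f ?b 1 = unary g"
    and b0: "\<And>l. l \<noteq> 2 \<Longrightarrow> on_nu ?b l = (\<lambda>_. 0)" "\<And>r. r \<noteq> 1 \<Longrightarrow> on_f ?b r = (\<lambda>_. 0)"
    by (simp_all add: beta_def)
  have zero: "on_mu \<theta> k = (\<lambda>_. 0)" "on_nu \<theta> k = (\<lambda>_. 0)" if "k \<noteq> n + 1 \<or> n + 1 < 2" for k
    using that by (auto intro!: \<theta>(4,5))
  have zero': "on_mu \<omega> k = (\<lambda>_. 0)" "on_nu \<omega> k = (\<lambda>_. 0)" if "k \<noteq> m + 1 \<or> m + 1 < 2" for k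
    using that by (auto intro!: \<omega>(4,5))
  have D: "on_mu (insertion ?b [\<theta>, \<omega>] [0, 1] 0) = on_mu \<theta>" "on_mu (insertion ?b [\<theta>, \<omega>] [0, 1] 1) = on_mu \<omega>"
    "on_mu (insertion ?b [\<theta>, \<omega>] [1, 0] 0) = on_mu \<omega>" "on_mu (insertion ?b [\<theta>, \<omega>] [1, 0] 1) = on_mu \<theta>"
    "on_nu (insertion ?b [\<theta>, \<omega>] [0, 1] 0) = on_nu \<theta>" "on_nu (insertion ?b [\<theta>, \<omega>] [0, 1] 1) = on_nu \<omega>"
    "on_nu (insertion ?b [\<theta>, \<omega>] [1, 0] 0) = on_nu \<omega>" "on_nu (insertion ?b [\<theta>, \<omega>] [1, 0] 1) = on_nu \<theta>"
    by (simp_all add: insertion_two)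
  note L = l_op_two[of sU sV ?b n \<theta> m \<omega>, folded assms(12)]
  note bracket_mu = l2_bracket[where T = "on_mu \<theta>" and W = "on_mu \<omega>" and n = n and m = m and L = "on_mu L"
      and D = "\<lambda>vs v. on_mu (insertion ?b [\<theta>, \<omega>] vs v)" and s = sU]
  note bracket_nu = l2_bracket[where T = "on_nu \<theta>" and W = "on_nu \<omega>" and n = n and m = m and L = "on_nu L"
      and D = "\<lambda>vs v. on_nu (insertion ?b [\<theta>, \<omega>] vs v)" and s = sV]
  have mu: "on_mu L (n + m + 1) xs = sU ((-1) ^ (m * n))
      (sgn_sum sU (unshuffles [m + 1, n]) (circ1 (m + 1) \<theta>U \<omega>U) xs
       + sU ((-1) ^ (m + n)) (sgn_sum sU (unshuffles [n + 1, m]) (circ1 (n + 1) \<omega>U \<theta>U) xs))"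
    if "length xs = n + m + 1" for xs
    unfolding assms(6,9)
    by (rule bracket_mu(1); (fact sU \<theta>(1) \<omega>(1) D L(1) that | erule zero(1) zero'(1)))
  have mu0: "on_mu L N = (\<lambda>_. 0)" if "N \<noteq> n + m + 1 \<or> N < 2" for N
    by (rule bracket_mu(2); (fact sU \<theta>(1) \<omega>(1) D L(1) that | erule zero(1) zero'(1)))
  have mu_skew: "on_mu L N \<in> skew_maps sU sU N" for N
    by (rule bracket_mu(3); (fact sU \<theta>(1) \<omega>(1) D L(1) | erule zero(1) zero'(1)))
  have nu: "on_nu L (n + m + 1) xs = sV ((-1) ^ (m * n))
      (sgn_sum sV (unshuffles [m + 1, n]) (circ1 (m + 1) \<theta>V \<omega>V) xs
       + sV ((-1) ^ (m + n)) (sgn_sum sV (unshuffles [n + 1, m]) (circ1 (n + 1) \<omega>V \<theta>V) xs))"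
    if "length xs = n + m + 1" for xs
    unfolding assms(7,10)
    by (rule bracket_nu(1); (fact sV \<theta>(2) \<omega>(2) D L(2) that | erule zero(2) zero'(2)))
  have nu0: "on_nu L N = (\<lambda>_. 0)" if "N \<noteq> n + m + 1 \<or> N < 2" for N
    by (rule bracket_nu(2); (fact sV \<theta>(2) \<omega>(2) D L(2) that | erule zero(2) zero'(2)))
  have nu_skew: "on_nu L N \<in> skew_maps sV sV N" for N
    by (rule bracket_nu(3); (fact sV \<theta>(2) \<omega>(2) D L(2) | erule zero(2) zero'(2)))

  \<comment> \<open>The value on f_(n+m) is split by the kind of graph: \<open>C\<close> has an
    \<open>f\<close> at the root, \<open>A\<close> a cochain at a \<open>\<nu>\<close> root,
    \<open>PQ\<close> the bracket there. \<open>C\<close> and \<open>A\<close> are skew in all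
    degrees; the parity condition concerns \<open>PQ\<close> only.\<close>
  define C where "C xs = sgn_sum sV (unshuffles [m + 1, n - 1]) (circ1 (m + 1) \<theta>g \<omega>U) xs
      + sgn_sum sV (unshuffles [n + 1, m - 1]) (circ1 (n + 1) \<omega>g \<theta>U) xs" for xs
  define A where "A xs = sgn_sum sV (unshuffles_lt_ones n m)
        (comp_tensor \<theta>V (replicate n (1, unary g) @ [(m, \<omega>g)])) xs
      + sgn_sum sV (unshuffles_lt_ones m n)
        (comp_tensor \<omega>V (replicate m (1, unary g) @ [(n, \<theta>g)])) xs" for xs
  define P where "P = sgn_sum sV (unshuffles_lt [n, m]) (comp_tensor (binary \<mu>V) [(n, \<theta>g), (m, \<omega>g)])"
  define Q where "Q = sgn_sum sV (unshuffles_lt [m, n]) (comp_tensor (binary \<mu>V) [(m, \<omega>g), (n, \<theta>g)])"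
  define PQ where "PQ xs = (if m < n then 0 else P xs) + sV ((-1) ^ (n + m)) (if n < m then 0 else Q xs)" for xs
  define \<Phi> where "\<Phi> xs = sV ((-1) ^ (m * (n - 1))) (C xs) + sV ((-1) ^ n) (A xs) - PQ xs" for xs

  have f: "on_f L N xs = (if length xs = N \<and> N = n + m then \<Phi> xs else 0)" for N xs
  proof (cases "length xs = N")
    case True
    have "lin_ext sV (\<lambda>\<Gamma>. \<Sum>vs\<in>vertex_tuples 2 (vertices_f \<Gamma>). gamma_f (insertion ?b [\<theta>, \<omega>] vs) \<Gamma> xs)
      (boundary_f N) =
    (if N = n + m then
      sgn_sum sV (unshuffles_lt_ones n m)
        (comp_tensor (on_nu \<theta> (Suc n)) (replicate n (1, unary g) @ [(m, on_f \<omega> m)])) xs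
      + sgn_sum sV (unshuffles_lt_ones m n)
        (comp_tensor (on_nu \<omega> (Suc m)) (replicate m (1, unary g) @ [(n, on_f \<theta> n)])) xs
      + ((if n \<le> m then sV ((-1) ^ (1 + n)) (sgn_sum sV (unshuffles_lt [n, m])
            (comp_tensor (binary \<mu>V) [(n, on_f \<theta> n), (m, on_f \<omega> m)]) xs) else 0)
        + (if m \<le> n then sV ((-1) ^ (1 + m)) (sgn_sum sV (unshuffles_lt [m, n])
            (comp_tensor (binary \<mu>V) [(m, on_f \<omega> m), (n, on_f \<theta> n)]) xs) else 0))
      - (sV ((-1) ^ ((m + 1) * (n - 1)))
          (sgn_sum sV (unshuffles [m + 1, n - 1]) (circ1 (m + 1) (on_f \<theta> n) (on_mu \<omega> (m + 1))) xs)
        + sV ((-1) ^ ((n + 1) * (m - 1)))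
          (sgn_sum sV (unshuffles [n + 1, m - 1]) (circ1 (n + 1) (on_f \<omega> m) (on_mu \<theta> (n + 1))) xs))
     else 0)"
      by (rule f_graph_sum; (fact sU sV b \<mu>V0 \<theta>(2,3) \<omega>(2,3) True | erule b0 \<theta>(4-6) \<omega>(4-6)))
    \<comment> \<open>The side condition of \<open>collect_signs\<close>: a cochain of degree
      \<open>0\<close> is zero, and each of the two composites contains a component of both
      cochains.\<close>
    moreover have "circ1 (m + 1) \<theta>g \<omega>U ys = 0 \<and> circ1 (n + 1) \<omega>g \<theta>U zs = 0"
      if "n = 0 \<or> m = 0" for ys zs
    proof -
      have "\<theta>g = (\<lambda>_. 0) \<or> \<omega>U = (\<lambda>_. 0)" "\<omega>g = (\<lambda>_. 0) \<or> \<theta>U = (\<lambda>_. 0)"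
        using that \<theta>g0 \<omega>g0 zero(1)[of "n + 1"] zero'(1)[of "m + 1"] unfolding assms(6,9) by auto
      moreover have "\<theta>g \<in> multilinear_maps sU sV n" "\<omega>g \<in> multilinear_maps sU sV m"
        using \<theta>g \<omega>g by (simp_all add: skew_maps_def)
      ultimately show ?thesis
        using circ1_zero_left circ1_zero_right by metis
    qed
    ultimately show ?thesis
      unfolding L(3) \<Phi>_def C_def A_def PQ_def P_def Q_def
      using True V.collect_signs[of n m] by (simp add: sgn_sum_0[OF sV] assms(6-11))
  qed (simp add: L(3))

  have pieces: "multilinear_on sU sV (n + m) C" "skew_on sV (n + m) {..<n + m} C"
    "multilinear_on sU sV (n + m) A" "skew_on sV (n + m) {..<n + m} A"
    "multilinear_on sU sV (n + m) PQ"
  proof -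
    note circ = sgn_sum_circ1_pred[OF sU sV]
    show "multilinear_on sU sV (n + m) C" "skew_on sV (n + m) {..<n + m} C"
      unfolding C_def
      by (intro multilinear_on_add skew_on_add sV circ; use skew \<theta>g0 \<omega>g0 in simp)+
    show "multilinear_on sU sV (n + m) A" "skew_on sV (n + m) {..<n + m} A"
      unfolding A_def
      by (intro multilinear_on_add skew_on_add sV sgn_sum_ones[OF sU sV g]; use skew in simp)+
    have P: "multilinear_on sU sV (n + m) P" and Q: "multilinear_on sU sV (n + m) Q"
      unfolding P_def Q_def by (intro multilinear_on_sgn_sum_binary[OF sU sV \<mu>V]; use skew in simp)+
    have "multilinear_on sU sV (n + m) (\<lambda>xs. if m < n then 0 else P xs)"
      using P multilinear_on_0[OF sU sV] by (cases "m < n") simp_all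
    moreover have "multilinear_on sU sV (n + m) (\<lambda>xs. if n < m then 0 else Q xs)"
      using Q multilinear_on_0[OF sU sV] by (cases "n < m") simp_all
    ultimately show "multilinear_on sU sV (n + m) PQ"
      unfolding PQ_def by (intro multilinear_on_add multilinear_on_scale)
  qed
  have PQ_skew: "skew_on sV (n + m) {..<n + m} PQ" if "n \<noteq> m \<or> odd n"
  proof -
    \<comment> \<open>For different degrees only one of \<open>P\<close> and \<open>Q\<close>
      remains, and its ordered unshuffles are all unshuffles. In the third case both remain, and
      neither needs to be skew by itself.\<close>
    consider "n < m" | "m < n" | "n = m" "odd n"
      using \<open>n \<noteq> m \<or> odd n\<close> by linarith
    then show ?thesis
    proof cases
      case 1
      then have "P = sgn_sum sV (unshuffles [n, m]) (comp_tensor (binary \<mu>V) [(n, \<theta>g), (m, \<omega>g)])"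
        unfolding P_def by (simp add: unshuffles_lt_two_neq)
      then have "skew_on sV (n + m) {..<n + m} P"
        using skew_on_sgn_sum_binary[OF sV \<mu>V \<theta>g \<omega>g] by simp
      then show ?thesis
        by (rule skew_on_cong) (use 1 in \<open>simp add: PQ_def\<close>)
    next
      case 2
      then have "Q = sgn_sum sV (unshuffles [m, n]) (comp_tensor (binary \<mu>V) [(m, \<omega>g), (n, \<theta>g)])"
        unfolding Q_def by (simp add: unshuffles_lt_two_neq)
      then have "skew_on sV (n + m) {..<n + m} Q"
        using skew_on_sgn_sum_binary[OF sV \<mu>V \<omega>g \<theta>g] by (simp add: add.commute)
      from skew_on_scale[OF sV this, of "(-1) ^ (n + m)"] show ?thesis
        by (rule skew_on_cong) (use 2 in \<open>simp add: PQ_def\<close>)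
    next
      case 3
      have "skew_on sV (n + n) {..<n + n}
          (sgn_sum sV (unshuffles [n, n]) (comp_tensor (binary \<mu>V) [(n, \<theta>g), (n, \<omega>g)]))"
        using skew_on_sgn_sum_binary[OF sV \<mu>V \<theta>g \<omega>g] 3 by simp
      \<comment> \<open>For \<open>n = m\<close> the sign in front of \<open>Q\<close> is +1.
        Antisymmetry of \<open>\<mu>V\<close> turns the bracket with exchanged arguments into minus
        the original one after a block exchange, so the two ordered sums merge into one over all
        unshuffles.\<close>
      moreover have "PQ xs =
          sgn_sum sV (unshuffles [n, n]) (comp_tensor (binary \<mu>V) [(n, \<theta>g), (n, \<omega>g)]) xs"
        if "length xs = n + n" for xs
      proof -
        have "comp_tensor (binary \<mu>V) [(n, \<omega>g), (n, \<theta>g)] ys =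
            - comp_tensor (binary \<mu>V) [(n, \<theta>g), (n, \<omega>g)] (permute_list (block_swap n n) ys)"
          if "length ys = n + n" for ys
          using that by (simp add: comp_tensor_binary permute_list_block_swap
              lie_algebra_antisym[OF assms(2), of "\<theta>g (drop n ys)"])
        then have "sgn_sum sV (unshuffles_lt [n, n]) (comp_tensor (binary \<mu>V) [(n, \<theta>g), (n, \<omega>g)]) xs
            + sgn_sum sV (unshuffles_lt [n, n]) (comp_tensor (binary \<mu>V) [(n, \<omega>g), (n, \<theta>g)]) xs =
            sgn_sum sV (unshuffles [n, n]) (comp_tensor (binary \<mu>V) [(n, \<theta>g), (n, \<omega>g)]) xs"
          by (rule sgn_sum_block_swap[OF sV \<open>odd n\<close> that])
        then show ?thesis
          unfolding PQ_def P_def Q_def using \<open>n = m\<close> by simp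
      qed
      ultimately have "skew_on sV (n + n) {..<n + n} PQ"
        by (rule skew_on_cong)
      then show ?thesis
        using \<open>n = m\<close> by simp
    qed
  qed

  \<comment> \<open>The formula \<open>f\<close> alone leaves open the arity \<open>0\<close> for
    \<open>n = m = 0\<close>. As f_0 is no generator the value must vanish there; it does because
    its differential is an empty sum.\<close>
  have f_zero: "on_f L N = (\<lambda>_. 0)" if "N \<noteq> n + m \<or> N = 0" for N
  proof (cases "N = n + m")
    case True
    then have "N = 0"
      using that by blast
    have empty: "{(i, j). i + j = Suc 0 \<and> Suc 0 \<le> i \<and> (2::nat) \<le> j} = {}"
      by auto
    have "boundary_f N = 0"
      using \<open>N = 0\<close> by (simp add: boundary_f_def empty)
    then show ?thesis
      by (simp add: fun_eq_iff L(3))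
  qed (simp add: fun_eq_iff f)
  \<comment> \<open>Kept apart from skewness because it holds for equal even degrees too; membership
    in \<open>graded_maps\<close> is derived from it without any parity condition.\<close>
  have f_multilinear: "on_f L N \<in> multilinear_maps sU sV N" for N
  proof (cases "N = n + m")
    case True
    have "multilinear_on sU sV (n + m) \<Phi>"
      unfolding \<Phi>_def by (intro multilinear_on_diff multilinear_on_add multilinear_on_scale pieces)
    then have "multilinear_on sU sV (n + m) (on_f L (n + m))"
      by (rule multilinear_on_cong) (simp add: f)
    then show ?thesis
      using True by (simp add: multilinear_maps_iff f)
  next
    case False
    then show ?thesis
      by (simp add: f_zero multilinear_maps_iff multilinear_on_0[OF sU sV])
  qed
  have f_skew: "on_f L N \<in> skew_maps sU sV N" if "n \<noteq> m \<or> odd n" for N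
  proof (cases "N = n + m")
    case True
    have "skew_on sV (n + m) {..<n + m} \<Phi>"
      unfolding \<Phi>_def by (intro skew_on_diff skew_on_add skew_on_scale sV pieces PQ_skew that)
    then have "skew_on sV (n + m) {..<n + m} (on_f L (n + m))"
      by (rule skew_on_cong) (simp add: f)
    then show ?thesis
      using True f_multilinear[of N] by (simp add: skew_maps_iff multilinear_maps_iff)
  next
    case False
    then show ?thesis
      by (simp add: f_zero zero_in_skew_maps[OF sU sV])
  qed

  have mult: "on_mu L k \<in> multilinear_maps sU sU k" "on_nu L k \<in> multilinear_maps sV sV k" for k
    using mu_skew nu_skew by (simp_all add: skew_maps_def)
  have "on_mu L k = (\<lambda>_. 0)" if "\<not> (is_generator (Mu k) \<and> generator_degree (Mu k) = int (n + m) - 1)" for k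
    using that by (intro mu0) auto
  moreover have "on_nu L k = (\<lambda>_. 0)" if "\<not> (is_generator (Nu k) \<and> generator_degree (Nu k) = int (n + m) - 1)" for k
    using that by (intro nu0) auto
  moreover have "on_f L k = (\<lambda>_. 0)" if "\<not> (is_generator (Fn k) \<and> generator_degree (Fn k) = int (n + m) - 1)" for k
    using that by (intro f_zero) auto
  ultimately have graded: "L \<in> graded_maps sU sV (n + m)"
    unfolding graded_maps_def using mult f_multilinear by blast
  have "L \<in> cochains sU sV (n + m)" if "n \<noteq> m \<or> odd n"
    unfolding cochains_def using graded mu_skew nu_skew f_skew[OF that] by blast
  moreover have "on_f L (n + m) xs = \<Phi> xs" if "length xs = n + m" for xs
    using that by (simp add: f)
  ultimately show ?thesis
    using graded mu_skew nu_skew mu nu unfolding \<Phi>_def C_def A_def PQ_def P_def Q_def by blast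
qed

end
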